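(* Let $n\geq 2$, let $p\in\mathbb{R}^n$, and let $\Phi:\mathcal{K}^n\to\mathcal{K}^n$ be a continuous, translation invariant Minkowski valuation satisfying (VC). Then either $\dim(\Phi(\{p\}))=0$ or $\dim(\Phi(\{p\}))=n-1$.
   Context: $\mathcal{K}^n$ is the space of convex bodies in $\mathbb{R}^n$ with the Hausdorff metric and Minkowski addition. A Minkowski valuation is a map $\Phi:\mathcal{K}^n\to\mathcal{K}^n$ with $\Phi(K)+\Phi(L)=\Phi(K\cup L)+\Phi(K\cap L)$ whenever $K,L,K\cup L\in\mathcal{K}^n$. Translation invariant: $\Phi(K+t)=\Phi(K)$. $\dim$ is the dimension of the affine hull. (VC): there are $c,C>0$ with $cV_n(K)\le V_n(\Phi(K))\le CV_n(K)$ for all $K$, $V_n$ the volume. *)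

theory Defs
  imports "HOL-Analysis.Analysis"
begin

definition convex_bodies :: "'a::euclidean_space set set" where
  "convex_bodies = {K. K \<noteq> {} \<and> compact K \<and> convex K}"

definition minkowski_sum :: "'a::euclidean_space set \<Rightarrow> 'a set \<Rightarrow> 'a set" where
  "minkowski_sum A B = {x + y | x y. x \<in> A \<and> y \<in> B}"

text \<open>Hausdorff distance (for nonempty compact sets).\<close>
definition hausdorff_dist :: "'a::euclidean_space set \<Rightarrow> 'a set \<Rightarrow> real" where
  "hausdorff_dist A B = max (SUP x\<in>A. setdist {x} B) (SUP y\<in>B. setdist {y} A)"

definition minkowski_valuation :: "('a::euclidean_space set \<Rightarrow> 'a set) \<Rightarrow> bool" where
  "minkowski_valuation \<Phi> \<longleftrightarrow>
     (\<forall>K\<in>convex_bodies. \<Phi> K \<in> convex_bodies) \<and>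
     (\<forall>K L. K \<in> convex_bodies \<longrightarrow> L \<in> convex_bodies \<longrightarrow> K \<union> L \<in> convex_bodies \<longrightarrow>
        minkowski_sum (\<Phi> K) (\<Phi> L) = minkowski_sum (\<Phi> (K \<union> L)) (\<Phi> (K \<inter> L)))"

definition translation_invariant :: "('a::euclidean_space set \<Rightarrow> 'a set) \<Rightarrow> bool" where
  "translation_invariant \<Phi> \<longleftrightarrow>
     (\<forall>K\<in>convex_bodies. \<forall>t. \<Phi> ((\<lambda>x. x + t) ` K) = \<Phi> K)"

definition hausdorff_continuous :: "('a::euclidean_space set \<Rightarrow> 'a set) \<Rightarrow> bool" where
  "hausdorff_continuous \<Phi> \<longleftrightarrow>
     (\<forall>K\<in>convex_bodies. \<forall>e>0. \<exists>d>0. \<forall>L\<in>convex_bodies.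
        hausdorff_dist L K < d \<longrightarrow> hausdorff_dist (\<Phi> L) (\<Phi> K) < e)"

definition volume_condition :: "('a::euclidean_space set \<Rightarrow> 'a set) \<Rightarrow> bool" where
  "volume_condition \<Phi> \<longleftrightarrow>
     (\<exists>c C. c > 0 \<and> C > 0 \<and> (\<forall>K\<in>convex_bodies.
        c * measure lebesgue K \<le> measure lebesgue (\<Phi> K) \<and>
        measure lebesgue (\<Phi> K) \<le> C * measure lebesgue K))"

end

theory Submission
  imports Defs
begin

text \<open>
  Applied to a parallelepiped with edges \<open>a\<^sub>i g\<^sub>i\<close>, the valuation property and translation invariance make
  the width of \<open>\<Phi>\<close> in every direction an affine function of each \<open>a\<^sub>i\<close>. Hence \<open>\<Phi>\<close> of the parallelepiped
  is, up to differences, a Minkowski polynomial whose coefficients are bodies \<open>Z I\<close> indexed by sets \<open>I\<close> of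
  edges, with \<open>Z {}\<close> coming from \<open>\<Phi> {0}\<close>. If \<open>n\<close> linearly independent vectors are taken from bodies
  \<open>Z (I 1), \<dots>, Z (I n)\<close>, the image contains a parallelepiped whose volume grows like
  the product of all \<open>a\<^sub>i\<close> with \<open>i \<in> I j\<close> over all \<open>j\<close>, so the upper volume bound forces the nonempty \<open>I j\<close> to partition the set
  of edges; by the lower bound such vectors exist. By exchange, the sets \<open>I\<close> for which \<open>Z I\<close> is not parallel to
  \<open>\<Phi> {0}\<close> form a partition into \<open>n - dim (\<Phi> {0})\<close> blocks, depending on the frame only. It is locally
  constant in the frame by continuity of \<open>\<Phi>\<close>, and rotating by a right angle in the plane of two edges swaps
  them. So the partition is invariant under transpositions, which leaves only the one-block partition
  and the partition into singletons.
\<close>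

section \<open>Widths of convex bodies\<close>

definition support_fun :: "'a::euclidean_space set \<Rightarrow> 'a \<Rightarrow> real" where
  "support_fun K u = (SUP x\<in>K. x \<bullet> u)"

text \<open>The support function of the difference body. Unlike a support function it is never
  negative, which is what \<open>affine_of_additive_nonneg\<close> asks for.\<close>

definition width :: "'a::euclidean_space set \<Rightarrow> 'a \<Rightarrow> real" where
  "width K u = support_fun K u + support_fun K (- u)"

definition differences :: "'a::euclidean_space set \<Rightarrow> 'a set" where
  "differences K = {x - y | x y. x \<in> K \<and> y \<in> K}"

lemma convex_bodiesD:
  assumes "K \<in> convex_bodies"
  shows "K \<noteq> {}" "compact K" "convex K" "bounded K" "closed K"
  using assms by (auto simp: convex_bodies_def compact_imp_bounded compact_imp_closed)

lemma bdd_above_inner: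
  assumes "bounded K"
  shows "bdd_above ((\<lambda>x. x \<bullet> u) ` K)"
proof -
  obtain M where "\<And>x. x \<in> K \<Longrightarrow> norm x \<le> M"
    using assms bounded_iff by blast
  then have "\<And>x. x \<in> K \<Longrightarrow> x \<bullet> u \<le> M * norm u"
    by (meson mult_right_mono norm_cauchy_schwarz norm_ge_zero order_trans)
  then show ?thesis by (auto intro!: bdd_aboveI2)
qed

lemma support_fun_upper:
  assumes "K \<in> convex_bodies" "x \<in> K"
  shows "x \<bullet> u \<le> support_fun K u"
  unfolding support_fun_def
  using assms by (intro cSUP_upper bdd_above_inner) (auto dest: convex_bodiesD)

lemma support_fun_least:
  assumes "K \<in> convex_bodies" "\<And>x. x \<in> K \<Longrightarrow> x \<bullet> u \<le> m"
  shows "support_fun K u \<le> m"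
  unfolding support_fun_def
  using assms by (intro cSUP_least) (auto dest: convex_bodiesD)

lemma support_fun_attained:
  assumes "K \<in> convex_bodies"
  obtains x where "x \<in> K" "x \<bullet> u = support_fun K u"
proof -
  have "\<exists>x\<in>K. \<forall>y\<in>K. y \<bullet> u \<le> x \<bullet> u"
    using convex_bodiesD[OF assms]
    by (intro continuous_attains_sup continuous_intros) auto
  then obtain x where x: "x \<in> K" "\<And>y. y \<in> K \<Longrightarrow> y \<bullet> u \<le> x \<bullet> u" by blast
  show ?thesis
    using that[of x] x support_fun_least[OF assms, of u "x \<bullet> u"] support_fun_upper[OF assms x(1), of u]
    by fastforce
qed

lemma minkowski_sum_convex_bodies:
  assumes "A \<in> convex_bodies" "B \<in> convex_bodies"
  shows "minkowski_sum A B \<in> convex_bodies"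
proof -
  have "minkowski_sum A B = (\<Union>x\<in>A. \<Union>y\<in>B. {x + y})"
    by (auto simp: minkowski_sum_def)
  then have "convex (minkowski_sum A B)"
    using convex_sums[of A B] convex_bodiesD[OF assms(1)] convex_bodiesD[OF assms(2)] by simp
  moreover have "compact (minkowski_sum A B)"
    unfolding minkowski_sum_def
    using compact_sums convex_bodiesD[OF assms(1)] convex_bodiesD[OF assms(2)] by blast
  moreover have "minkowski_sum A B \<noteq> {}"
    unfolding minkowski_sum_def using convex_bodiesD[OF assms(1)] convex_bodiesD[OF assms(2)] by blast
  ultimately show ?thesis by (simp add: convex_bodies_def)
qed

lemma support_fun_minkowski_sum:
  assumes "A \<in> convex_bodies" "B \<in> convex_bodies"
  shows "support_fun (minkowski_sum A B) u = support_fun A u + support_fun B u"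
proof (rule antisym)
  show "support_fun (minkowski_sum A B) u \<le> support_fun A u + support_fun B u"
    by (rule support_fun_least[OF minkowski_sum_convex_bodies[OF assms]])
       (auto simp: minkowski_sum_def inner_add_left intro!: add_mono support_fun_upper assms)
  obtain x y where "x \<in> A" "x \<bullet> u = support_fun A u" "y \<in> B" "y \<bullet> u = support_fun B u"
    using support_fun_attained assms by metis
  then show "support_fun A u + support_fun B u \<le> support_fun (minkowski_sum A B) u"
    using support_fun_upper[OF minkowski_sum_convex_bodies[OF assms], of "x + y" u]
    by (auto simp: minkowski_sum_def inner_add_left)
qed

lemma width_minkowski_sum:
  assumes "A \<in> convex_bodies" "B \<in> convex_bodies"
  shows "width (minkowski_sum A B) u = width A u + width B u"
  by (simp add: width_def support_fun_minkowski_sum[OF assms])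

lemma differences_convex_bodies:
  assumes "K \<in> convex_bodies"
  shows "differences K \<in> convex_bodies"
proof -
  have "differences K = (\<Union>x\<in>K. \<Union>y\<in>K. {x - y})"
    by (auto simp: differences_def)
  then have "convex (differences K)"
    using convex_differences[of K K] convex_bodiesD[OF assms] by simp
  moreover have "compact (differences K)"
    unfolding differences_def
    using compact_differences convex_bodiesD[OF assms] by blast
  moreover have "differences K \<noteq> {}"
    unfolding differences_def using convex_bodiesD[OF assms] by blast
  ultimately show ?thesis by (simp add: convex_bodies_def)
qed

lemma differences_inner_le_width:
  assumes "K \<in> convex_bodies" "v \<in> differences K"
  shows "v \<bullet> u \<le> width K u"
proof -
  obtain x y where "v = x - y" "x \<in> K" "y \<in> K"
    using assms by (auto simp: differences_def)
  then show ?thesis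
    using support_fun_upper[OF assms(1), of x u] support_fun_upper[OF assms(1), of y "- u"]
    by (simp add: width_def inner_diff_left)
qed

lemma width_attained:
  assumes "K \<in> convex_bodies"
  obtains v where "v \<in> differences K" "v \<bullet> u = width K u"
proof -
  obtain x y where "x \<in> K" "x \<bullet> u = support_fun K u" "y \<in> K" "y \<bullet> (- u) = support_fun K (- u)"
    using support_fun_attained assms by metis
  then show ?thesis
    using that[of "x - y"] by (auto simp: differences_def width_def inner_diff_left)
qed

lemma width_nonneg:
  assumes "K \<in> convex_bodies"
  shows "0 \<le> width K u"
proof -
  have "0 \<in> differences K"
    using convex_bodiesD(1)[OF assms] by (auto simp: differences_def)
  then show ?thesis using differences_inner_le_width[OF assms, of 0 u] by simp
qed

text \<open>The difference body is closed and convex, so a hyperplane separating a point from it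
  yields a direction in which the width bound fails.\<close>

lemma differences_iff_width:
  assumes "K \<in> convex_bodies"
  shows "v \<in> differences K \<longleftrightarrow> (\<forall>u. v \<bullet> u \<le> width K u)"
proof
  assume v: "\<forall>u. v \<bullet> u \<le> width K u"
  show "v \<in> differences K"
  proof (rule ccontr)
    assume "v \<notin> differences K"
    then obtain a b where ab: "a \<bullet> v < b" "\<And>x. x \<in> differences K \<Longrightarrow> b < a \<bullet> x"
      using separating_hyperplane_closed_point convex_bodiesD[OF differences_convex_bodies[OF assms]]
      by metis
    obtain w where "w \<in> differences K" "w \<bullet> (- a) = width K (- a)"
      using width_attained[OF assms] by blast
    moreover have "v \<bullet> (- a) \<le> width K (- a)" using v by blast
    ultimately show False using ab(1) ab(2)[of w] by (simp add: inner_commute)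
  qed
qed (use differences_inner_le_width[OF assms] in blast)

section \<open>Hausdorff distance and widths\<close>

lemma hausdorff_dist_less_imp:
  assumes "A \<in> convex_bodies" "B \<in> convex_bodies" "hausdorff_dist A B < e" "x \<in> A"
  obtains y where "y \<in> B" "dist x y < e"
proof -
  obtain b where b: "b \<in> B" using convex_bodiesD(1)[OF assms(2)] by blast
  obtain M where M: "\<And>x. x \<in> A \<Longrightarrow> dist b x \<le> M"
    using convex_bodiesD(4)[OF assms(1)] bounded_any_center by metis
  have "bdd_above ((\<lambda>x. setdist {x} B) ` A)"
  proof (rule bdd_aboveI2)
    fix x assume "x \<in> A"
    then show "setdist {x} B \<le> M"
      using M setdist_le_dist[of x "{x}" b B] b by (fastforce simp: dist_commute)
  qed
  then have "setdist {x} B \<le> (SUP x\<in>A. setdist {x} B)"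
    using assms(4) by (rule cSUP_upper2) auto
  also have "\<dots> < e" using assms(3) by (simp add: hausdorff_dist_def)
  finally have "setdist {x} B < e" .
  moreover obtain y where "y \<in> B" "setdist {x} B = dist x y"
    using setdist_compact_closed[of "{x}" B] convex_bodiesD(1,5)[OF assms(2)] by force
  ultimately show ?thesis using that by metis
qed

lemma hausdorff_dist_commute: "hausdorff_dist A B = hausdorff_dist B A"
  by (simp add: hausdorff_dist_def max.commute)

lemma hausdorff_dist_le:
  assumes "A \<in> convex_bodies" "B \<in> convex_bodies"
    and "\<And>x. x \<in> A \<Longrightarrow> \<exists>y\<in>B. dist x y \<le> e" "\<And>y. y \<in> B \<Longrightarrow> \<exists>x\<in>A. dist x y \<le> e"
  shows "hausdorff_dist A B \<le> e"
proof -
  have "(SUP x\<in>A. setdist {x} B) \<le> e"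
  proof (rule cSUP_least)
    fix x assume "x \<in> A"
    then obtain y where "y \<in> B" "dist x y \<le> e" using assms(3) by blast
    then show "setdist {x} B \<le> e" using setdist_le_dist[of x "{x}" y B] by simp
  qed (use convex_bodiesD[OF assms(1)] in simp)
  moreover have "(SUP x\<in>B. setdist {x} A) \<le> e"
  proof (rule cSUP_least)
    fix y assume "y \<in> B"
    then obtain x where "x \<in> A" "dist x y \<le> e" using assms(4) by blast
    then show "setdist {y} A \<le> e" using setdist_le_dist[of y "{y}" x A] by (simp add: dist_commute)
  qed (use convex_bodiesD[OF assms(2)] in simp)
  ultimately show ?thesis by (simp add: hausdorff_dist_def)
qed

lemma support_fun_hausdorff_le:
  assumes "A \<in> convex_bodies" "B \<in> convex_bodies" "hausdorff_dist A B < e"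
  shows "support_fun A u \<le> support_fun B u + e * norm u"
proof (rule support_fun_least[OF assms(1)])
  fix x assume "x \<in> A"
  then obtain y where y: "y \<in> B" "dist x y < e"
    using hausdorff_dist_less_imp[OF assms] by blast
  have "x \<bullet> u - y \<bullet> u \<le> norm (x - y) * norm u"
    by (metis inner_diff_left norm_cauchy_schwarz)
  also have "\<dots> \<le> e * norm u"
    using y(2) by (intro mult_right_mono) (auto simp: dist_norm)
  finally show "x \<bullet> u \<le> support_fun B u + e * norm u"
    using support_fun_upper[OF assms(2) y(1), of u] by linarith
qed

lemma width_hausdorff_le:
  assumes "A \<in> convex_bodies" "B \<in> convex_bodies" "hausdorff_dist A B < e"
  shows "\<bar>width A u - width B u\<bar> \<le> 2 * e * norm u"
  using support_fun_hausdorff_le[OF assms, of u] support_fun_hausdorff_le[OF assms, of "- u"]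
    support_fun_hausdorff_le[OF assms(2,1), of e u] support_fun_hausdorff_le[OF assms(2,1), of e "- u"]
    assms(3)
  by (simp add: width_def hausdorff_dist_commute)

text \<open>Subtracting \<open>f 0\<close> leaves an additive \<open>g\<close>. As \<open>f\<close>
  is bounded below, multiples of a negative value of \<open>g\<close> are impossible; so
  \<open>g\<close> is nonnegative, hence monotone, hence linear.\<close>

lemma affine_of_additive_nonneg:
  fixes f :: "real \<Rightarrow> real"
  assumes add: "\<And>s t. 0 \<le> s \<Longrightarrow> 0 \<le> t \<Longrightarrow> f (s + t) + f 0 = f s + f t"
    and nonneg: "\<And>t. 0 \<le> t \<Longrightarrow> 0 \<le> f t"
    and "0 \<le> t"
  shows "f t = f 0 + t * (f 1 - f 0)"
proof -
  define g where "g t = f t - f 0" for t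
  have g_add: "g (s + t) = g s + g t" if "0 \<le> s" "0 \<le> t" for s t
    using add[OF that] by (simp add: g_def)
  have g_mult: "g (real n * t) = real n * g t" if "0 \<le> t" for n t
  proof (induction n)
    case (Suc n)
    have "g (real (Suc n) * t) = g (real n * t + t)" by (simp add: algebra_simps)
    also have "\<dots> = real n * g t + g t" using g_add that Suc by simp
    finally show ?case by (simp add: algebra_simps)
  qed (simp add: g_def)
  have g_nonneg: "0 \<le> g t" if "0 \<le> t" for t
  proof (rule ccontr)
    assume "\<not> 0 \<le> g t"
    then obtain n :: nat where "f 0 < real n * (- g t)"
      using reals_Archimedean3[of "- g t"] by auto
    then have "f 0 < - g (real n * t)" using g_mult[OF that, of n] by simp
    then have "f (real n * t) < 0" by (simp add: g_def)
    then show False using nonneg[of "real n * t"] that by simp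
  qed
  have g_mono: "g s \<le> g t" if "0 \<le> s" "s \<le> t" for s t
    using g_add[of s "t - s"] g_nonneg[of "t - s"] that by simp
  \<comment> \<open>Both \<open>real n * g t\<close> and \<open>real n * t * g 1\<close> lie between
    \<open>real k * g 1\<close> and \<open>(real k + 1) * g 1\<close>, where \<open>k\<close> is the
    floor of \<open>real n * t\<close>; letting \<open>n\<close> grow closes the gap.\<close>
  have "\<bar>g t - t * g 1\<bar> * real n \<le> g 1" for n :: nat
  proof -
    define k where "k = nat \<lfloor>real n * t\<rfloor>"
    have k: "real k \<le> real n * t" "real n * t \<le> real k + 1"
      using \<open>0 \<le> t\<close> by (auto simp: k_def)
    have "real k * g 1 \<le> real n * g t"
      using g_mono[of "real k" "real n * t"] k g_mult[of 1 k] g_mult[OF \<open>0 \<le> t\<close>, of n] by simp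
    moreover have "real n * g t \<le> (real k + 1) * g 1"
      using g_mono[of "real n * t" "real (Suc k)"] k g_mult[of 1 "Suc k"] g_mult[OF \<open>0 \<le> t\<close>, of n] \<open>0 \<le> t\<close>
      by (simp add: add.commute)
    moreover have "real k * g 1 \<le> (real n * t) * g 1" "(real n * t) * g 1 \<le> (real k + 1) * g 1"
      using k g_nonneg[of 1] by (auto intro!: mult_right_mono)
    moreover have "\<bar>g t - t * g 1\<bar> * real n = \<bar>real n * g t - (real n * t) * g 1\<bar>"
      by (simp add: abs_mult_pos' right_diff_distrib mult.commute mult.left_commute)
    ultimately show ?thesis by (simp add: algebra_simps)
  qed
  then have "g t = t * g 1"
    by (metis abs_le_zero_iff eq_iff_diff_eq_0 linorder_not_le mult.commute reals_Archimedean3)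
  then show ?thesis by (simp add: g_def)
qed

section \<open>Translation invariant valuations on parallelepipeds\<close>

text \<open>The parallelepiped at the origin with edges \<open>a i *\<^sub>R g i\<close>. A zero
  side is allowed, so the facet along which two boxes are glued is again of this form up to
  translation.\<close>

definition pbox :: "('a::euclidean_space \<Rightarrow> 'a) \<Rightarrow> ('a \<Rightarrow> real) \<Rightarrow> 'a set" where
  "pbox g a = g ` {x. \<forall>i\<in>Basis. 0 \<le> x \<bullet> i \<and> x \<bullet> i \<le> a i}"

lemma pbox_cbox: "pbox g a = g ` cbox 0 (\<Sum>i\<in>Basis. a i *\<^sub>R i)"
  by (simp add: pbox_def cbox_def)

lemma pbox_convex_bodies:
  assumes "linear g" "\<And>i. i \<in> Basis \<Longrightarrow> 0 \<le> a i"
  shows "pbox g a \<in> convex_bodies"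
proof -
  have "0 \<in> pbox g a"
    using assms linear_0[OF assms(1)] by (force simp: pbox_def)
  moreover have "compact (pbox g a)"
    unfolding pbox_cbox
    using assms(1) by (simp add: compact_continuous_image linear_continuous_on linear_linear)
  moreover have "convex (pbox g a)"
    unfolding pbox_cbox using assms(1) by (simp add: convex_linear_image)
  ultimately show ?thesis by (auto simp: convex_bodies_def)
qed

text \<open>The boxes with side lengths \<open>s\<close> and \<open>t\<close> in direction \<open>g i\<close> are glued along a common facet.\<close>

lemma translation_invariant_valuation_pbox_affine:
  fixes \<phi> :: "'a::euclidean_space set \<Rightarrow> real"
  assumes val: "\<And>K L. K \<in> convex_bodies \<Longrightarrow> L \<in> convex_bodies \<Longrightarrow> K \<union> L \<in> convex_bodies \<Longrightarrow>
       K \<inter> L \<in> convex_bodies \<Longrightarrow> \<phi> K + \<phi> L = \<phi> (K \<union> L) + \<phi> (K \<inter> L)"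
    and trans: "\<And>K x. K \<in> convex_bodies \<Longrightarrow> \<phi> ((\<lambda>y. y + x) ` K) = \<phi> K"
    and nonneg: "\<And>K. K \<in> convex_bodies \<Longrightarrow> 0 \<le> \<phi> K"
    and g: "linear g" "inj g" and a: "\<And>j. j \<in> Basis \<Longrightarrow> 0 \<le> a j"
    and i: "i \<in> Basis" and t: "0 \<le> t"
  shows "\<phi> (pbox g (a(i := t))) =
    \<phi> (pbox g (a(i := 0))) + t * (\<phi> (pbox g (a(i := 1))) - \<phi> (pbox g (a(i := 0))))"
proof -
  have cb: "pbox g (a(i := s)) \<in> convex_bodies" if "0 \<le> s" for s
    using that a by (intro pbox_convex_bodies g) auto
  have glue: "\<phi> (pbox g (a(i := s + t))) + \<phi> (pbox g (a(i := 0))) =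
      \<phi> (pbox g (a(i := s))) + \<phi> (pbox g (a(i := t)))" if "0 \<le> s" "0 \<le> t" for s t
  proof -
    have shift: "(\<lambda>y. y + s *\<^sub>R g i) ` pbox g (a(i := r)) =
        g ` {x. (\<forall>j\<in>Basis - {i}. 0 \<le> x \<bullet> j \<and> x \<bullet> j \<le> a j) \<and> s \<le> x \<bullet> i \<and> x \<bullet> i \<le> s + r}"
      (is "_ = g ` ?R") for r
    proof -
      let ?Q = "{x. \<forall>j\<in>Basis. 0 \<le> x \<bullet> j \<and> x \<bullet> j \<le> (a(i := r)) j}"
      have "(\<lambda>x. x + s *\<^sub>R i) ` ?Q = ?R"
      proof (intro equalityI subsetI)
        fix x assume "x \<in> ?R"
        then have "x - s *\<^sub>R i \<in> ?Q"
          using i by (auto simp: inner_diff_left inner_Basis algebra_simps)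
        then show "x \<in> (\<lambda>x. x + s *\<^sub>R i) ` ?Q"
          by (metis (no_types, lifting) diff_add_cancel image_eqI)
      qed (use i in \<open>auto simp: inner_add_left inner_Basis split: if_splits\<close>)
      then have "g ` ?R = (\<lambda>x. g (x + s *\<^sub>R i)) ` ?Q" by (metis (no_types, lifting) image_image image_cong)
      also have "\<dots> = (\<lambda>y. y + s *\<^sub>R g i) ` pbox g (a(i := r))"
        by (simp add: pbox_def image_image linear_add[OF g(1)] linear_scale[OF g(1)])
      finally show ?thesis by simp
    qed
    let ?K = "pbox g (a(i := s))" and ?L = "(\<lambda>y. y + s *\<^sub>R g i) ` pbox g (a(i := t))"
    have split: "pbox g (a(i := r)) =
       g ` {x. (\<forall>j\<in>Basis - {i}. 0 \<le> x \<bullet> j \<and> x \<bullet> j \<le> a j) \<and> 0 \<le> x \<bullet> i \<and> x \<bullet> i \<le> r}" for r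
      unfolding pbox_def using i by (intro arg_cong[where f="image g"]) auto
    have un: "?K \<union> ?L = pbox g (a(i := s + t))"
      unfolding split[of "s + t"] split[of s] shift[of t] image_Un[symmetric]
      using that by (intro arg_cong[where f="image g"]) auto
    \<comment> \<open>The common facet supplies the correction term \<open>f 0\<close> in the
      additivity hypothesis of \<open>affine_of_additive_nonneg\<close>.\<close>
    have int: "?K \<inter> ?L = (\<lambda>y. y + s *\<^sub>R g i) ` pbox g (a(i := 0))"
      unfolding split[of s] shift image_Int[OF g(2), symmetric]
      using that by (intro arg_cong[where f="image g"]) auto
    have tr: "(\<lambda>y. y + s *\<^sub>R g i) ` M \<in> convex_bodies" if "M \<in> convex_bodies" for M
      using convex_bodiesD[OF that] compact_translation[of M "s *\<^sub>R g i"] convex_translation[of M "s *\<^sub>R g i"]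
      by (simp add: convex_bodies_def add.commute image_is_empty)
    have "\<phi> ?K + \<phi> ?L = \<phi> (?K \<union> ?L) + \<phi> (?K \<inter> ?L)"
      using that by (intro val) (auto simp: un int intro!: tr cb)
    then show ?thesis
      unfolding un int using trans cb that by simp
  qed
  show ?thesis
    using affine_of_additive_nonneg[where f="\<lambda>t. \<phi> (pbox g (a(i := t)))", OF glue nonneg[OF cb] t] by simp
qed

text \<open>Volume is itself a nonnegative translation invariant valuation, hence affine in each
  side. A box with a zero side is negligible, so there is no constant term.\<close>

lemma measure_pbox:
  fixes g :: "'a::euclidean_space \<Rightarrow> 'a"
  assumes g: "linear g" "inj g" and a: "\<And>j. j \<in> Basis \<Longrightarrow> 0 \<le> a j"
  shows "measure lebesgue (pbox g a) = (\<Prod>i\<in>Basis. a i) * measure lebesgue (pbox g (\<lambda>_. 1))"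
proof -
  have step: "measure lebesgue (pbox g (b(i := t))) = t * measure lebesgue (pbox g (b(i := 1)))"
    if b: "\<And>j. j \<in> Basis \<Longrightarrow> 0 \<le> b j" and i: "i \<in> Basis" and t: "0 \<le> t" for b i t
  proof -
    have "pbox g (b(i := 0)) \<subseteq> g ` {x. i \<bullet> x = 0}"
      unfolding pbox_def using i by (intro image_mono) (auto simp: inner_commute intro: antisym)
    moreover have "negligible (g ` {x. i \<bullet> x = 0})"
    proof (rule negligible_lowdim)
      have "dim (g ` {x. i \<bullet> x = 0}) \<le> dim {x. i \<bullet> x = 0}"
        using g(1) by (rule dim_image_le)
      also have "\<dots> = DIM('a) - 1" using i by (intro dim_hyperplane) auto
      also have "\<dots> < DIM('a)" by simp
      finally show "dim (g ` {x. i \<bullet> x = 0}) < DIM('a)" .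
    qed
    ultimately have "measure lebesgue (pbox g (b(i := 0))) = 0"
      using negligible_subset negligible_imp_measure0 by blast
    moreover have "measure lebesgue (pbox g (b(i := t))) = measure lebesgue (pbox g (b(i := 0)))
       + t * (measure lebesgue (pbox g (b(i := 1))) - measure lebesgue (pbox g (b(i := 0))))"
    proof (rule translation_invariant_valuation_pbox_affine[OF _ _ _ g b i t])
      fix K L :: "'a set" assume "K \<in> convex_bodies" "L \<in> convex_bodies"
      then show "measure lebesgue K + measure lebesgue L = measure lebesgue (K \<union> L) + measure lebesgue (K \<inter> L)"
        by (simp add: measure_Un3 lmeasurable_compact convex_bodiesD)
    next
      fix K :: "'a set" and x :: 'a
      show "measure lebesgue ((\<lambda>y. y + x) ` K) = measure lebesgue K"
        using measure_translation[of x K] by (simp add: add.commute)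
    qed auto
    ultimately show ?thesis by simp
  qed
  \<comment> \<open>The sides are changed from \<open>1\<close> to \<open>a i\<close> one at a
    time.\<close>
  have "measure lebesgue (pbox g (\<lambda>i. if i \<in> A then a i else 1)) =
      (\<Prod>i\<in>A. a i) * measure lebesgue (pbox g (\<lambda>_. 1))" if "finite A" "A \<subseteq> Basis" for A
    using that
  proof (induction rule: finite_induct)
    case (insert i A)
    have eq: "(\<lambda>j. if j \<in> insert i A then a j else 1) = (\<lambda>j. if j \<in> A then a j else 1)(i := a i)"
      "(\<lambda>j. if j \<in> A then a j else 1)(i := 1) = (\<lambda>j. if j \<in> A then a j else 1)"
      using insert.hyps by auto
    show ?case
      unfolding eq(1) using step[of "\<lambda>j. if j \<in> A then a j else 1" i "a i"] insert a by (simp add: eq(2))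
  qed simp
  moreover have "pbox g (\<lambda>i. if i \<in> Basis then a i else 1) = pbox g a"
    by (simp add: pbox_def)
  ultimately show ?thesis by (metis finite_Basis order_refl)
qed

lemma measure_pbox_pos:
  fixes g :: "'a::euclidean_space \<Rightarrow> 'a"
  assumes "linear g" "inj g" and a: "\<And>j. j \<in> Basis \<Longrightarrow> 0 < a j"
  shows "0 < measure lebesgue (pbox g a)"
proof -
  have "box 0 (\<Sum>i\<in>Basis. a i *\<^sub>R i) \<noteq> {}"
    using a by (simp add: box_ne_empty)
  moreover have "open (g ` box 0 (\<Sum>i\<in>Basis. a i *\<^sub>R i))"
    using assms by (intro open_surjective_linear_image) (auto simp: linear_injective_imp_surjective)
  moreover have "g ` box 0 (\<Sum>i\<in>Basis. a i *\<^sub>R i) \<subseteq> pbox g a"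
    unfolding pbox_cbox by (intro image_mono box_subset_cbox)
  ultimately have "interior (pbox g a) \<noteq> {}"
    using interior_maximal by blast
  moreover have "pbox g a \<in> convex_bodies" using assms by (intro pbox_convex_bodies) (auto simp: less_imp_le)
  ultimately show ?thesis
    using negligible_convex_interior[of "pbox g a"] negligible_iff_measure0[of "pbox g a"]
    by (simp add: convex_bodiesD lmeasurable_compact zero_less_measure_iff less_le)
qed

section \<open>Multiaffine functions\<close>

text \<open>Moebius inversion over the vertices of the unit cube.\<close>

definition coef :: "(('i \<Rightarrow> real) \<Rightarrow> real) \<Rightarrow> 'i set \<Rightarrow> real" where
  "coef F I = (\<Sum>J\<in>Pow I. (- 1) ^ card (I - J) * F (indicator J))"

lemma sum_Pow_insert:
  assumes "finite S" "i \<notin> S"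
  shows "(\<Sum>I\<in>Pow (insert i S). f I) = (\<Sum>I\<in>Pow S. f I) + (\<Sum>I\<in>Pow S. f (insert i I))"
proof -
  have "inj_on (insert i) (Pow S)"
    using assms(2) by (fastforce simp: inj_on_def)
  moreover have "Pow S \<inter> insert i ` Pow S = {}"
    using assms(2) by auto
  ultimately show ?thesis
    using assms(1) by (simp add: Pow_insert sum.union_disjoint sum.reindex)
qed

text \<open>Subsets of \<open>insert i I\<close> are sorted by whether they contain
  \<open>i\<close>. In the induction for \<open>multiaffine_expansion\<close>, the coefficients that
  involve \<open>i\<close> are thus those of the slope of \<open>F\<close> in the variable
  \<open>i\<close>.\<close>

lemma coef_insert:
  assumes "finite I" "i \<notin> I"
  shows "coef F (insert i I) = coef (\<lambda>a. F (a(i := 1)) - F (a(i := 0))) I"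
proof -
  have 1: "(- 1) ^ card (insert i I - J) * F (indicator J) = - ((- 1) ^ card (I - J) * F ((indicator J)(i := 0)))"
    if "J \<in> Pow I" for J
  proof -
    have "insert i I - J = insert i (I - J)" "(indicator J)(i := 0) = (indicator J :: _ \<Rightarrow> real)"
      using that assms by (auto simp: indicator_def fun_eq_iff)
    then show ?thesis using assms by simp
  qed
  have 2: "(- 1) ^ card (insert i I - insert i J) * F (indicator (insert i J)) =
      (- 1) ^ card (I - J) * F ((indicator J)(i := 1))"
    if "J \<in> Pow I" for J
  proof -
    have "insert i I - insert i J = I - J"
      "(indicator J)(i := 1) = (indicator (insert i J) :: _ \<Rightarrow> real)"
      using that assms by (auto simp: indicator_def fun_eq_iff)
    then show ?thesis by simp
  qed
  have "coef F (insert i I) =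
      (\<Sum>J\<in>Pow I. - ((- 1) ^ card (I - J) * F ((indicator J)(i := 0)))) +
      (\<Sum>J\<in>Pow I. (- 1) ^ card (I - J) * F ((indicator J)(i := 1)))"
    unfolding coef_def sum_Pow_insert[OF assms] by (intro arg_cong2[where f="(+)"] sum.cong refl 1 2)
  then show ?thesis
    by (simp add: coef_def sum_negf right_diff_distrib sum_subtractf)
qed

text \<open>Induction on \<open>S\<close>: affinity in \<open>i\<close> gives
  \<open>F a = F b + a i * G b\<close> with \<open>b = a(i := 0)\<close> and \<open>G\<close> the
  slope in \<open>i\<close>, and \<open>F\<close> and \<open>G\<close> are both affine in each
  remaining variable.\<close>

lemma multiaffine_expansion:
  fixes F :: "('i \<Rightarrow> real) \<Rightarrow> real"
  assumes "finite S"
    and "\<And>a i t. (\<forall>j. 0 \<le> a j) \<Longrightarrow> i \<in> S \<Longrightarrow> 0 \<le> t \<Longrightarrow>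
      F (a(i := t)) = F (a(i := 0)) + t * (F (a(i := 1)) - F (a(i := 0)))"
    and "\<forall>j. 0 \<le> a j" "\<And>j. j \<notin> S \<Longrightarrow> a j = 0"
  shows "F a = (\<Sum>I\<in>Pow S. (\<Prod>i\<in>I. a i) * coef F I)"
  using assms
proof (induction S arbitrary: F a rule: finite_induct)
  case empty
  \<comment> \<open>For empty \<open>S\<close> the vanishing hypothesis makes \<open>a\<close>
    identically zero.\<close>
  then have "F a = F (indicator {})" by (intro arg_cong[where f=F]) auto
  then show ?case by (simp add: coef_def)
next
  case (insert i S)
  define b where "b = a(i := 0)"
  define G where "G c = F (c(i := 1)) - F (c(i := 0))" for c
  have b: "\<forall>j. 0 \<le> b j" "\<And>j. j \<notin> S \<Longrightarrow> b j = 0" "b(i := 0) = b" "b(i := 1) = a(i := 1)"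
    using insert.prems(2,3) by (auto simp: b_def)
  have 1: "F b = (\<Sum>I\<in>Pow S. (\<Prod>i\<in>I. b i) * coef F I)"
    using b by (intro insert.IH insert.prems(1)) auto
  have 2: "G b = (\<Sum>I\<in>Pow S. (\<Prod>i\<in>I. b i) * coef G I)"
  proof (rule insert.IH)
    fix c :: "'i \<Rightarrow> real" and j :: 'i and t :: real
    assume c: "\<forall>j. 0 \<le> c j" "j \<in> S" and t: "0 \<le> t"
    then have "j \<noteq> i" using insert.hyps(2) by auto
    then have sw: "c(j := s, i := r) = c(i := r, j := s)" for s r by (simp add: fun_upd_twist)
    have "F (c(j := t, i := r)) = F (c(j := 0, i := r)) + t * (F (c(j := 1, i := r)) - F (c(j := 0, i := r)))"
      if "0 \<le> r" for r
      unfolding sw using c t that by (intro insert.prems(1)) auto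
    from this[of 0] this[of 1]
    show "G (c(j := t)) = G (c(j := 0)) + t * (G (c(j := 1)) - G (c(j := 0)))"
      by (simp add: G_def algebra_simps)
  qed (use b in auto)
  have pb: "(\<Prod>k\<in>I. b k) = (\<Prod>k\<in>I. a k)" "(\<Prod>k\<in>insert i I. a k) = a i * (\<Prod>k\<in>I. a k)"
    "coef F (insert i I) = coef G I" if "I \<in> Pow S" for I
  proof -
    have I: "finite I" "i \<notin> I" using that insert.hyps finite_subset by auto
    then show "(\<Prod>k\<in>I. b k) = (\<Prod>k\<in>I. a k)" by (intro prod.cong) (auto simp: b_def)
    show "(\<Prod>k\<in>insert i I. a k) = a i * (\<Prod>k\<in>I. a k)" using I by simp
    show "coef F (insert i I) = coef G I" using coef_insert[OF I, of F] by (simp add: G_def[abs_def])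
  qed
  have "F a = F (b(i := a i))" by (simp add: b_def)
  also have "\<dots> = F (b(i := 0)) + a i * (F (b(i := 1)) - F (b(i := 0)))"
    using b(1) insert.prems(2) by (intro insert.prems(1)) auto
  also have "\<dots> = F b + a i * G b"
    by (simp only: G_def b(3))
  also have "\<dots> = (\<Sum>I\<in>Pow (insert i S). (\<Prod>i\<in>I. a i) * coef F I)"
    unfolding 1 2 sum_Pow_insert[OF insert.hyps] sum_distrib_left
    using pb by (intro arg_cong2[where f="(+)"] sum.cong) (auto simp: mult.assoc)
  finally show ?case .
qed

text \<open>Convexity puts into \<open>K\<close> the average of the segments from \<open>y j\<close>
  to \<open>x j\<close>, where \<open>x j - y j = b j *\<^sub>R h j\<close>. This average is a
  parallelepiped with edges \<open>(b j / n) *\<^sub>R h j\<close>, with \<open>n\<close> the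
  dimension.\<close>

lemma measure_ge_of_differences:
  fixes h :: "'a::euclidean_space \<Rightarrow> 'a"
  assumes K: "K \<in> convex_bodies" and h: "linear h" "inj h"
    and b: "\<And>j. j \<in> Basis \<Longrightarrow> 0 < b j"
    and diff: "\<And>j. j \<in> Basis \<Longrightarrow> b j *\<^sub>R h j \<in> differences K"
  shows "(\<Prod>j\<in>Basis. b j / real DIM('a)) * measure lebesgue (pbox h (\<lambda>_. 1)) \<le> measure lebesgue K"
proof -
  have "\<forall>j\<in>Basis. \<exists>x y. x \<in> K \<and> y \<in> K \<and> b j *\<^sub>R h j = x - y"
    using diff by (fastforce simp: differences_def)
  then obtain x y where xy: "\<And>j. j \<in> Basis \<Longrightarrow> x j \<in> K \<and> y j \<in> K \<and> b j *\<^sub>R h j = x j - y j"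
    by metis
  define n where "n = real DIM('a)"
  have n: "0 < n" by (simp add: n_def)
  define y0 where "y0 = (\<Sum>j\<in>Basis. (1 / n) *\<^sub>R y j)"
  have "(+) y0 ` pbox h (\<lambda>j. b j / n) \<subseteq> K"
  proof clarify
    fix z assume "z \<in> pbox h (\<lambda>j. b j / n)"
    then obtain c where c: "z = h c" "\<And>j. j \<in> Basis \<Longrightarrow> 0 \<le> c \<bullet> j \<and> c \<bullet> j \<le> b j / n"
      by (auto simp: pbox_def)
    \<comment> \<open>The fraction of the \<open>j\<close>-th segment to travel in order to reach
      \<open>y0 + z\<close>; the factor \<open>n\<close> undoes the averaging.\<close>
    define l where "l j = n * (c \<bullet> j) / b j" for j
    have l: "0 \<le> l j" "l j \<le> 1" if "j \<in> Basis" for j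
      using c(2)[OF that] b[OF that] n by (auto simp: l_def field_simps)
    have "z = h (\<Sum>j\<in>Basis. (c \<bullet> j) *\<^sub>R j)" by (simp add: c(1) euclidean_representation)
    also have "\<dots> = (\<Sum>j\<in>Basis. (c \<bullet> j) *\<^sub>R h j)"
      by (simp add: linear_sum[OF h(1)] linear_scale[OF h(1)])
    also have "\<dots> = (\<Sum>j\<in>Basis. (1 / n) *\<^sub>R (l j *\<^sub>R (x j - y j)))"
    proof (rule sum.cong)
      fix j :: 'a assume j: "j \<in> Basis"
      have "x j - y j = b j *\<^sub>R h j" using xy[OF j] by simp
      then show "(c \<bullet> j) *\<^sub>R h j = (1 / n) *\<^sub>R (l j *\<^sub>R (x j - y j))"
        using b[OF j] n by (simp add: l_def)
    qed simp
    finally have "y0 + z = (\<Sum>j\<in>Basis. (1 / n) *\<^sub>R (y j + l j *\<^sub>R (x j - y j)))"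
      by (simp add: y0_def sum.distrib scaleR_add_right)
    also have "\<dots> \<in> K"
    proof (rule convex_sum)
      fix j :: 'a assume j: "j \<in> Basis"
      have "y j + l j *\<^sub>R (x j - y j) = (1 - l j) *\<^sub>R y j + l j *\<^sub>R x j" by (simp add: algebra_simps)
      then show "y j + l j *\<^sub>R (x j - y j) \<in> K"
        using convexD_alt[OF convex_bodiesD(3)[OF K], of "y j" "x j" "l j"] xy[OF j] l[OF j] by simp
    qed (use n convex_bodiesD(3)[OF K] in \<open>auto simp: n_def\<close>)
    finally show "y0 + z \<in> K" .
  qed
  moreover have "pbox h (\<lambda>j. b j / n) \<in> convex_bodies"
    using b n h by (intro pbox_convex_bodies) (auto simp: less_imp_le)
  ultimately have "measure lebesgue ((+) y0 ` pbox h (\<lambda>j. b j / n)) \<le> measure lebesgue K"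
    using K by (intro measure_mono_fmeasurable)
      (auto simp: lmeasurable_compact convex_bodiesD measurable_translation fmeasurableD)
  then show ?thesis
    using measure_pbox[OF h, of "\<lambda>j. b j / n"] b n by (simp add: measure_translation less_imp_le n_def)
qed

section \<open>Images of parallelepipeds\<close>

locale volume_constrained_valuation =
  fixes \<Phi> :: "'a::euclidean_space set \<Rightarrow> 'a set"
  assumes valuation: "minkowski_valuation \<Phi>"
    and continuous: "hausdorff_continuous \<Phi>"
    and translation: "translation_invariant \<Phi>"
    and volume: "volume_condition \<Phi>"
begin

definition box_width :: "('a \<Rightarrow> 'a) \<Rightarrow> 'a \<Rightarrow> ('a \<Rightarrow> real) \<Rightarrow> real" where
  "box_width g u a = width (\<Phi> (pbox g a)) u"

text \<open>The body \<open>\<Phi> (pbox g a)\<close> is a Minkowski polynomial in the side lengths \<open>a\<close>; the set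
  \<open>coef_body g I\<close> is the difference body of its coefficient at \<open>\<Prod>i\<in>I. a i\<close>.\<close>

definition coef_body :: "('a \<Rightarrow> 'a) \<Rightarrow> 'a set \<Rightarrow> 'a set" where
  "coef_body g I = {v. \<forall>u. v \<bullet> u \<le> coef (box_width g u) I}"

lemma \<Phi>_convex_bodies: "K \<in> convex_bodies \<Longrightarrow> \<Phi> K \<in> convex_bodies"
  using valuation by (simp add: minkowski_valuation_def)

lemma box_width_affine:
  assumes "linear g" "inj g" "\<forall>j. 0 \<le> a j" "i \<in> Basis" "0 \<le> t"
  shows "box_width g u (a(i := t)) =
    box_width g u (a(i := 0)) + t * (box_width g u (a(i := 1)) - box_width g u (a(i := 0)))"
  unfolding box_width_def
proof (rule translation_invariant_valuation_pbox_affine[where \<phi>="\<lambda>K. width (\<Phi> K) u"])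
  fix K L :: "'a set"
  assume "K \<in> convex_bodies" "L \<in> convex_bodies" "K \<union> L \<in> convex_bodies" "K \<inter> L \<in> convex_bodies"
  then show "width (\<Phi> K) u + width (\<Phi> L) u = width (\<Phi> (K \<union> L)) u + width (\<Phi> (K \<inter> L)) u"
    using valuation by (metis minkowski_valuation_def width_minkowski_sum)
next
  fix K x assume "K \<in> (convex_bodies :: 'a set set)"
  then show "width (\<Phi> ((\<lambda>y. y + x) ` K)) u = width (\<Phi> K) u"
    using translation by (simp add: translation_invariant_def)
qed (use assms width_nonneg \<Phi>_convex_bodies in auto)

lemma box_width_expansion:
  assumes "linear g" "inj g" "\<And>j. j \<in> Basis \<Longrightarrow> 0 \<le> a j"
  shows "box_width g u a = (\<Sum>I\<in>Pow Basis. (\<Prod>i\<in>I. a i) * coef (box_width g u) I)"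
proof -
  \<comment> \<open>\<open>multiaffine_expansion\<close> wants side lengths that vanish off
    \<open>Basis\<close>; \<open>pbox\<close> does not notice the truncation.\<close>
  define b where "b i = (if i \<in> Basis then a i else 0)" for i
  have "box_width g u a = box_width g u b" by (simp add: box_width_def pbox_def b_def)
  also have "\<dots> = (\<Sum>I\<in>Pow Basis. (\<Prod>i\<in>I. b i) * coef (box_width g u) I)"
    using assms by (intro multiaffine_expansion box_width_affine) (auto simp: b_def)
  also have "\<dots> = (\<Sum>I\<in>Pow Basis. (\<Prod>i\<in>I. a i) * coef (box_width g u) I)"
    by (intro sum.cong arg_cong2[where f="(*)"] prod.cong) (auto simp: b_def)
  finally show ?thesis .
qed

section \<open>Coefficients as limits of rescaled images\<close>

lemma box_width_nonneg:
  assumes "linear g" "\<And>j. j \<in> Basis \<Longrightarrow> 0 \<le> a j"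
  shows "0 \<le> box_width g u a"
  unfolding box_width_def using assms by (intro width_nonneg \<Phi>_convex_bodies pbox_convex_bodies) auto

text \<open>With sides \<open>Suc m\<close> along \<open>I\<close> and \<open>0\<close> elsewhere
  only monomials with \<open>J \<subseteq> I\<close> survive, and dividing by
  \<open>real (Suc m) ^ card I\<close> leaves \<open>J = I\<close> in the limit. This turns an
  alternating sum into a limit of widths.\<close>

lemma coef_limit:
  assumes g: "linear g" "inj g" and I: "I \<subseteq> Basis"
  shows "(\<lambda>m. box_width g u (\<lambda>i. if i \<in> I then real (Suc m) else 0) / real (Suc m) ^ card I)
    \<longlonglongrightarrow> coef (box_width g u) I"
proof -
  let ?a = "\<lambda>m i. if i \<in> I then real (Suc m) else 0"
  have finI: "finite I" using I finite_subset[OF _ finite_Basis] by blast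
  have lim: "(\<lambda>m. (\<Prod>i\<in>J. ?a m i) / real (Suc m) ^ card I) \<longlonglongrightarrow> (if J = I then 1 else 0)"
    if J: "J \<subseteq> Basis" for J
  proof -
    have finJ: "finite J" using J finite_subset[OF _ finite_Basis] by blast
    consider "J = I" | "\<not> J \<subseteq> I" | "J \<subset> I" by auto
    then show ?thesis
    proof cases
      case 1
      then show ?thesis using finI by simp
    next
      case 2
      then have "(\<Prod>i\<in>J. ?a m i) = 0" for m using finJ by (auto intro!: prod_zero)
      then show ?thesis using 2 by auto
    next
      case 3
      then have c: "card J < card I" using finI by (simp add: psubset_card_mono)
      have "(\<Prod>i\<in>J. ?a m i) / real (Suc m) ^ card I = inverse (real (Suc m)) ^ (card I - card J)" for m
      proof -
        have "(\<Prod>i\<in>J. ?a m i) = (\<Prod>i\<in>J. real (Suc m))"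
          using 3 by (intro prod.cong) auto
        then show ?thesis using c by (simp add: power_diff power_inverse divide_simps del: of_nat_Suc)
      qed
      moreover have "(\<lambda>m. inverse (real (Suc m)) ^ (card I - card J)) \<longlonglongrightarrow> 0 ^ (card I - card J)"
        by (intro tendsto_power LIMSEQ_inverse_real_of_nat)
      moreover have "(0::real) ^ (card I - card J) = 0" using c by simp
      ultimately show ?thesis using 3 by simp
    qed
  qed
  have "(\<lambda>m. \<Sum>J\<in>Pow Basis. (\<Prod>i\<in>J. ?a m i) / real (Suc m) ^ card I * coef (box_width g u) J)
      \<longlonglongrightarrow> (\<Sum>J\<in>Pow Basis. (if J = I then 1 else 0) * coef (box_width g u) J)"
    by (intro tendsto_sum tendsto_mult lim tendsto_const) auto
  moreover have "(\<Sum>J\<in>Pow Basis. (if J = I then 1 else 0) * coef (box_width g u) J) = coef (box_width g u) I"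
    using I by (simp add: if_distrib[of "\<lambda>x. x * _"] sum.delta' cong: if_cong)
  moreover have "box_width g u (?a m) / real (Suc m) ^ card I =
      (\<Sum>J\<in>Pow Basis. (\<Prod>i\<in>J. ?a m i) / real (Suc m) ^ card I * coef (box_width g u) J)" for m
    by (subst box_width_expansion[OF g]) (auto simp: sum_divide_distrib)
  ultimately show ?thesis by simp
qed

lemma coef_nonneg:
  assumes "linear g" "inj g" "I \<subseteq> Basis"
  shows "0 \<le> coef (box_width g u) I"
  by (rule LIMSEQ_le_const[OF coef_limit[OF assms]])
     (auto intro!: exI[of _ 0] divide_nonneg_nonneg box_width_nonneg assms(1))

text \<open>Makes the coefficient the support function of \<open>coef_body g I\<close>. Points
  realising the widths along \<open>u\<close>, rescaled as in \<open>coef_limit\<close>, have a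
  convergent subsequence; the limit obeys all the bounds and is sharp at \<open>u\<close>.\<close>

lemma coef_body_attained:
  assumes g: "linear g" "inj g" and I: "I \<subseteq> Basis"
  obtains v where "v \<in> coef_body g I" "v \<bullet> u = coef (box_width g u) I"
proof -
  let ?K = "\<lambda>m. \<Phi> (pbox g (\<lambda>i. if i \<in> I then real (Suc m) else 0))"
  define s where "s m u' = width (?K m) u' / real (Suc m) ^ card I" for m u'
  have lim: "(\<lambda>m. s m u') \<longlonglongrightarrow> coef (box_width g u') I" for u'
    using coef_limit[OF g I, of u'] by (simp add: s_def box_width_def)
  have K: "?K m \<in> convex_bodies" for m
    by (intro \<Phi>_convex_bodies pbox_convex_bodies g) auto
  have "\<forall>m. \<exists>v. v \<in> differences (?K m) \<and> v \<bullet> u = width (?K m) u"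
    using width_attained[OF K] by metis
  then obtain v where v: "\<And>m. v m \<in> differences (?K m)" "\<And>m. v m \<bullet> u = width (?K m) u"
    by metis
  define x where "x m = v m /\<^sub>R real (Suc m) ^ card I" for m
  have xu: "x m \<bullet> u = s m u" for m by (simp add: x_def s_def v(2) divide_inverse_commute)
  have xle: "x m \<bullet> u' \<le> s m u'" for m u'
    using differences_inner_le_width[OF K v(1), of m u']
    by (simp add: x_def s_def divide_inverse_commute mult_left_mono)
  have s0: "0 \<le> s m u'" for m u' by (simp add: s_def width_nonneg[OF K])
  \<comment> \<open>Widths along the signed coordinate directions control the norm, and they
    converge, so \<open>x\<close> is bounded.\<close>
  have "norm (x m) \<le> (\<Sum>b\<in>Basis. s m b + s m (- b))" for m
  proof -
    have "\<bar>x m \<bullet> b\<bar> \<le> s m b + s m (- b)" for b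
      using xle[of m b] xle[of m "- b"] s0[of m b] s0[of m "- b"] by (simp add: abs_le_iff)
    then show ?thesis by (intro order_trans[OF norm_le_l1] sum_mono)
  qed
  moreover have "(\<lambda>m. \<Sum>b\<in>Basis. s m b + s m (- b)) \<longlonglongrightarrow>
      (\<Sum>b\<in>Basis. coef (box_width g b) I + coef (box_width g (- b)) I)"
    by (intro tendsto_sum tendsto_add lim)
  then have "Bseq (\<lambda>m. \<Sum>b\<in>Basis. s m b + s m (- b))"
    by (intro convergent_imp_Bseq) (auto simp: convergent_def)
  then obtain M where "\<And>m. norm (\<Sum>b\<in>Basis. s m b + s m (- b)) \<le> M"
    by (auto simp: Bseq_def)
  ultimately have "norm (x m) \<le> M" for m
    by (smt (verit, best) real_norm_def)
  then have "bounded (range x)" by (auto simp: bounded_iff)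
  then obtain l r where lr: "strict_mono (r :: nat \<Rightarrow> nat)" "(x \<circ> r) \<longlonglongrightarrow> l"
    using bounded_imp_convergent_subsequence by blast
  have xl: "(\<lambda>m. x (r m) \<bullet> u') \<longlonglongrightarrow> l \<bullet> u'" for u'
    using lr(2) by (intro tendsto_inner tendsto_const) (simp add: comp_def)
  have sl: "(\<lambda>m. s (r m) u') \<longlonglongrightarrow> coef (box_width g u') I" for u'
    using LIMSEQ_subseq_LIMSEQ[OF lim[of u'] lr(1)] by (simp add: comp_def)
  have "l \<bullet> u' \<le> coef (box_width g u') I" for u'
    by (rule LIMSEQ_le[OF xl sl]) (auto simp: xle)
  moreover have "l \<bullet> u = coef (box_width g u) I"
    using LIMSEQ_unique[OF xl[of u]] sl[of u] by (simp add: xu)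
  ultimately show ?thesis using that by (auto simp: coef_body_def)
qed

text \<open>All coefficients are nonnegative, so the single term of \<open>I\<close> in the
  expansion is at most the whole width.\<close>

lemma scaled_coef_body:
  assumes g: "linear g" "inj g" and I: "I \<subseteq> Basis" and a: "\<And>j. j \<in> Basis \<Longrightarrow> 0 \<le> a j"
    and v: "v \<in> coef_body g I"
  shows "(\<Prod>i\<in>I. a i) *\<^sub>R v \<in> differences (\<Phi> (pbox g a))"
proof -
  have p: "0 \<le> (\<Prod>i\<in>J. a i)" if "J \<subseteq> Basis" for J
    using that a by (intro prod_nonneg) auto
  have "(\<Prod>i\<in>I. a i) * (v \<bullet> u) \<le> width (\<Phi> (pbox g a)) u" for u
  proof -
    have "(\<Prod>i\<in>I. a i) * (v \<bullet> u) \<le> (\<Prod>i\<in>I. a i) * coef (box_width g u) I"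
      using v p[OF I] by (auto simp: coef_body_def intro!: mult_left_mono)
    also have "\<dots> \<le> (\<Sum>J\<in>Pow Basis. (\<Prod>i\<in>J. a i) * coef (box_width g u) J)"
      using I p coef_nonneg[OF g]
      by (intro member_le_sum[where f="\<lambda>J. (\<Prod>i\<in>J. a i) * coef (box_width g u) J"]) auto
    also have "\<dots> = width (\<Phi> (pbox g a)) u"
      using box_width_expansion[OF g a] by (simp add: box_width_def)
    finally show ?thesis .
  qed
  then show ?thesis
    using differences_iff_width[OF \<Phi>_convex_bodies[OF pbox_convex_bodies[OF g(1) a]]] by simp
qed

text \<open>Otherwise some nonzero \<open>u\<close> is orthogonal to all coefficient bodies, so the
  image of the box with unit sides has width \<open>0\<close> along \<open>u\<close> and volume
  \<open>0\<close>, against the lower volume bound.\<close>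

lemma span_coef_bodies:
  assumes g: "linear g" "inj g"
  shows "span (\<Union>I\<in>Pow Basis. coef_body g I) = UNIV"
proof (rule ccontr)
  assume "\<not> ?thesis"
  then obtain u where u: "u \<noteq> 0" "span (\<Union>I\<in>Pow Basis. coef_body g I) \<subseteq> {x. u \<bullet> x = 0}"
    using span_not_univ_subset_hyperplane by blast
  have z: "coef (box_width g w) I = 0" if "I \<in> Pow Basis" "w = u \<or> w = - u" for I w
  proof -
    obtain v where "v \<in> coef_body g I" "v \<bullet> w = coef (box_width g w) I"
      using coef_body_attained[OF g] \<open>I \<in> Pow Basis\<close> by blast
    moreover from this have "v \<in> span (\<Union>I\<in>Pow Basis. coef_body g I)"
      using that by (intro span_base) auto
    then have "u \<bullet> v = 0" using u(2) by blast
    ultimately show ?thesis using that(2) by (auto simp: inner_commute)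
  qed
  let ?K = "\<Phi> (pbox g (\<lambda>_. 1))"
  have K: "?K \<in> convex_bodies" "pbox g (\<lambda>_. 1) \<in> convex_bodies"
    using g by (auto intro!: \<Phi>_convex_bodies pbox_convex_bodies)
  obtain x0 where x0: "x0 \<in> ?K" using convex_bodiesD(1)[OF K(1)] by blast
  have w0: "width ?K w = 0" if "w = u \<or> w = - u" for w
    using box_width_expansion[OF g, of "\<lambda>_. 1" w] z that by (simp add: box_width_def)
  have "?K \<subseteq> {x. u \<bullet> x = u \<bullet> x0}"
  proof
    fix x assume "x \<in> ?K"
    then have "x - x0 \<in> differences ?K" using x0 by (auto simp: differences_def)
    from differences_inner_le_width[OF K(1) this, of u] differences_inner_le_width[OF K(1) this, of "- u"]
    have "x \<bullet> u = x0 \<bullet> u" using w0 by (simp add: inner_diff_left)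
    then show "x \<in> {x. u \<bullet> x = u \<bullet> x0}" by (simp add: inner_commute)
  qed
  then have "negligible ?K" using u(1) negligible_hyperplane negligible_subset by blast
  then have "measure lebesgue ?K = 0" by (rule negligible_imp_measure0)
  moreover have "0 < measure lebesgue (pbox g (\<lambda>_. 1))" using g by (intro measure_pbox_pos) auto
  ultimately show False
    using volume K(2) unfolding volume_condition_def by (metis linorder_not_le mult_pos_pos)
qed

text \<open>Stretching the box in direction \<open>g i\<close> by \<open>t\<close> multiplies its volume by \<open>t\<close>, but the volume of
  its image contains a parallelepiped that grows like \<open>t ^ card {v \<in> V. i \<in> \<iota> v}\<close>.\<close>

lemma coef_body_basis_label:
  assumes g: "linear g" "inj g" and V: "independent V" "card V = DIM('a)"
    and lab: "\<And>v. v \<in> V \<Longrightarrow> \<iota> v \<subseteq> Basis \<and> v \<in> coef_body g (\<iota> v)"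
    and i: "i \<in> Basis"
  shows "card {v \<in> V. i \<in> \<iota> v} = 1"
proof -
  define N where "N = card {v \<in> V. i \<in> \<iota> v}"
  have finV: "finite V" using V(1) by (rule finiteI_independent)
  then obtain \<pi> where \<pi>: "bij_betw \<pi> (Basis :: 'a set) V"
    using V(2) finite_same_card_bij[OF finite_Basis finV] by auto
  \<comment> \<open>The linear map sending the standard basis to \<open>V\<close> through
    \<open>\<pi>\<close>; it is onto because \<open>V\<close> spans, hence injective.\<close>
  define h where "h x = (\<Sum>j\<in>Basis. (x \<bullet> j) *\<^sub>R \<pi> j)" for x
  have h: "linear h"
    unfolding h_def by (intro linearI) (simp_all add: inner_add_left scaleR_add_left sum.distrib scaleR_sum_right)
  have hB: "h j = \<pi> j" if "j \<in> Basis" for j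
  proof -
    have "h j = (\<Sum>k\<in>Basis. if k = j then \<pi> k else 0)"
      unfolding h_def using that by (intro sum.cong) (auto simp: inner_Basis)
    then show ?thesis using that by simp
  qed
  have "V \<subseteq> range h"
    using \<pi> hB by (metis bij_betw_imp_surj_on image_subset_iff rangeI)
  then have "span V \<subseteq> range h"
    by (rule span_minimal) (use linear_subspace_image[OF h subspace_UNIV] in simp)
  moreover have "span V = UNIV" using V by (metis dim_eq_card_independent dim_eq_full)
  ultimately have inj: "inj h" using h by (simp add: linear_surjective_imp_injective top.extremum_unique)
  obtain C where C: "0 < C" "\<And>K. K \<in> convex_bodies \<Longrightarrow> measure lebesgue (\<Phi> K) \<le> C * measure lebesgue K"
    using volume unfolding volume_condition_def by metis
  define P where "P = (1 / real DIM('a)) ^ DIM('a) * measure lebesgue (pbox h (\<lambda>_. 1))"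
  define Q where "Q = C * measure lebesgue (pbox g (\<lambda>_. 1))"
  have P: "0 < P" unfolding P_def using h inj by (intro mult_pos_pos measure_pbox_pos) auto
  have Q: "0 < Q" unfolding Q_def using g C by (intro mult_pos_pos measure_pbox_pos) auto
  have main: "t ^ N * P \<le> t * Q" if t: "0 < t" for t
  proof -
    define a where "a j = (if j = i then t else 1)" for j
    define b where "b j = (if i \<in> \<iota> (\<pi> j) then t else 1)" for j
    \<comment> \<open>Only the side \<open>i\<close> differs from \<open>1\<close>, so the monomial
      of a label is \<open>t\<close> or \<open>1\<close> according to whether the label contains
      \<open>i\<close>.\<close>
    have b_eq: "b j = (\<Prod>k\<in>\<iota> (\<pi> j). a k)" if "j \<in> Basis" for j
    proof -
      have "finite (\<iota> (\<pi> j))"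
        using lab[of "\<pi> j"] that \<pi> finite_subset[OF _ finite_Basis] by (metis bij_betwE)
      then show ?thesis by (simp add: a_def b_def prod.delta)
    qed
    have "b j *\<^sub>R h j \<in> differences (\<Phi> (pbox g a))" if "j \<in> Basis" for j
    proof -
      have "\<pi> j \<in> V" using that \<pi> by (metis bij_betwE)
      then show ?thesis
        unfolding hB[OF that] b_eq[OF that] using lab t by (intro scaled_coef_body g) (auto simp: a_def)
    qed
    moreover have box: "pbox g a \<in> convex_bodies" using t by (intro pbox_convex_bodies g) (auto simp: a_def)
    ultimately have "(\<Prod>j\<in>Basis. b j / real DIM('a)) * measure lebesgue (pbox h (\<lambda>_. 1))
        \<le> measure lebesgue (\<Phi> (pbox g a))"
      using t by (intro measure_ge_of_differences \<Phi>_convex_bodies h inj) (auto simp: b_def)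
    also have "\<dots> \<le> C * measure lebesgue (pbox g a)" using C(2) box by blast
    also have "\<dots> = t * Q"
    proof -
      have "(\<Prod>j\<in>Basis. a j) = t" unfolding a_def using i by (simp add: prod.delta)
      then show ?thesis using measure_pbox[OF g, of a] t by (simp add: a_def Q_def)
    qed
    also have "(\<Prod>j\<in>Basis. b j / real DIM('a)) = t ^ N * (1 / real DIM('a)) ^ DIM('a)"
    proof -
      have "(\<Prod>j\<in>Basis. b j) = (\<Prod>v\<in>V. if i \<in> \<iota> v then t else 1)"
        unfolding b_def using prod.reindex_bij_betw[OF \<pi>, of "\<lambda>v. if i \<in> \<iota> v then t else 1"] by simp
      also have "\<dots> = t ^ N"
        using finV by (simp add: prod.If_cases N_def Collect_conj_eq)
      finally show ?thesis by (simp add: prod_dividef power_one_over)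
    qed
    finally show ?thesis by (simp add: P_def mult.assoc)
  qed
  \<comment> \<open>\<open>main\<close> compares \<open>t ^ N\<close> with \<open>t\<close>: small
    \<open>t\<close> rules out \<open>N = 0\<close>, large \<open>t\<close> rules out
    \<open>N \<ge> 2\<close>.\<close>
  have "N \<noteq> 0"
  proof
    assume "N = 0"
    then show False using main[of "P / (2 * Q)"] P Q by simp
  qed
  moreover have "\<not> 2 \<le> N"
  proof
    assume N: "2 \<le> N"
    define t where "t = 1 + Q / P"
    have t: "1 \<le> t" using P Q by (simp add: t_def)
    then have "t * (t * P) \<le> t ^ N * P"
      using power_increasing[OF N t] P by (simp add: power2_eq_square flip: mult.assoc)
    also have "\<dots> \<le> t * Q" using main t by simp
    finally have "t * P \<le> Q" using t by simp
    moreover have "t * P = P + Q" using P by (simp add: t_def distrib_right)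
    ultimately show False using P by simp
  qed
  ultimately show ?thesis unfolding N_def by linarith
qed

end

text \<open>The signs depend only on \<open>card (I - J)\<close>, which a bijection preserves.
  Applied below to the transposition of two edges.\<close>

lemma coef_reindex:
  assumes \<tau>: "bij \<tau>" and FG: "\<And>J. J \<subseteq> I \<Longrightarrow> F (indicator J) = G (indicator (\<tau> ` J))"
  shows "coef F I = coef G (\<tau> ` I)"
proof -
  have inj: "inj \<tau>" using \<tau> by (rule bij_is_inj)
  have "coef G (\<tau> ` I) = (\<Sum>J\<in>image \<tau> ` Pow I. (- 1) ^ card (\<tau> ` I - J) * G (indicator J))"
    by (simp add: coef_def image_Pow_surj)
  also have "\<dots> = (\<Sum>J\<in>Pow I. (- 1) ^ card (\<tau> ` I - \<tau> ` J) * G (indicator (\<tau> ` J)))"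
    using inj by (subst sum.reindex) (auto simp: inj_on_def inj_image_eq_iff)
  also have "\<dots> = coef F I"
    unfolding coef_def
  proof (intro sum.cong refl arg_cong2[where f="(*)"])
    fix J assume "J \<in> Pow I"
    then show "G (indicator (\<tau> ` J)) = F (indicator J)" using FG by simp
    have "\<tau> ` I - \<tau> ` J = \<tau> ` (I - J)" using inj by (simp add: image_set_diff)
    then show "(- 1) ^ card (\<tau> ` I - \<tau> ` J) = (- 1) ^ card (I - J)"
      using inj by (simp add: card_image inj_on_subset)
  qed
  finally show ?thesis by simp
qed

text \<open>Since \<open>y - z = (y - x) - (z - x)\<close>, the set \<open>differences K\<close> and
  the translate of \<open>K\<close> by \<open>- x\<close> have the same span.\<close>

lemma aff_dim_eq_dim_differences:
  assumes "K \<noteq> {}"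
  shows "aff_dim K = int (dim (differences K))"
proof -
  obtain x where x: "x \<in> K" using assms by blast
  have "dim (differences K) = dim ((\<lambda>y. y - x) ` K)"
  proof (rule antisym)
    show "dim ((\<lambda>y. y - x) ` K) \<le> dim (differences K)"
      using x by (intro dim_subset) (auto simp: differences_def)
    show "dim (differences K) \<le> dim ((\<lambda>y. y - x) ` K)"
    proof (rule dim_mono)
      show "differences K \<subseteq> span ((\<lambda>y. y - x) ` K)"
      proof
        fix v assume "v \<in> differences K"
        then obtain y z where "y \<in> K" "z \<in> K" "v = (y - x) - (z - x)"
          by (auto simp: differences_def)
        then show "v \<in> span ((\<lambda>y. y - x) ` K)" by (metis imageI span_base span_diff)
      qed
    qed
  qed
  then show ?thesis using aff_dim_eq_dim_subtract[OF hull_inc[OF x]] by simp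
qed

section \<open>Rotating the frame\<close>

text \<open>For orthonormal \<open>j\<close> and \<open>k\<close>, the rotation by
  \<open>\<theta>\<close> from \<open>j\<close> towards \<open>k\<close>, written as the identity
  plus a correction in their plane.\<close>

definition plane_rotation :: "'a::euclidean_space \<Rightarrow> 'a \<Rightarrow> real \<Rightarrow> 'a \<Rightarrow> 'a" where
  "plane_rotation j k \<theta> x = x + ((cos \<theta> - 1) * (x \<bullet> j) - sin \<theta> * (x \<bullet> k)) *\<^sub>R j
     + (sin \<theta> * (x \<bullet> j) + (cos \<theta> - 1) * (x \<bullet> k)) *\<^sub>R k"

lemma plane_rotation_0 [simp]: "plane_rotation j k 0 = (\<lambda>x. x)"
  by (simp add: plane_rotation_def fun_eq_iff)

lemma linear_plane_rotation: "linear (plane_rotation j k \<theta>)"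
  by (rule linearI) (simp_all add: plane_rotation_def inner_add_left algebra_simps)

lemma plane_rotation_inner:
  assumes "j \<in> Basis" "k \<in> Basis" "j \<noteq> k"
  shows "plane_rotation j k \<theta> x \<bullet> j = cos \<theta> * (x \<bullet> j) - sin \<theta> * (x \<bullet> k)"
    and "plane_rotation j k \<theta> x \<bullet> k = sin \<theta> * (x \<bullet> j) + cos \<theta> * (x \<bullet> k)"
    and "i \<in> Basis \<Longrightarrow> i \<noteq> j \<Longrightarrow> i \<noteq> k \<Longrightarrow> plane_rotation j k \<theta> x \<bullet> i = x \<bullet> i"
  using assms by (auto simp: plane_rotation_def inner_add_left inner_Basis algebra_simps)

text \<open>The \<open>j\<close> and \<open>k\<close> coordinates of a kernel vector solve a
  homogeneous system of determinant \<open>cos \<theta> ^ 2 + sin \<theta> ^ 2 = 1\<close>; the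
  other coordinates are left unchanged.\<close>

lemma inj_plane_rotation:
  fixes j k :: "'a::euclidean_space"
  assumes jk: "j \<in> Basis" "k \<in> Basis" "j \<noteq> k"
  shows "inj (plane_rotation j k \<theta>)"
proof -
  have "x = 0" if x: "plane_rotation j k \<theta> x = 0" for x
  proof (rule euclidean_eqI)
    fix i :: 'a assume i: "i \<in> Basis"
    have 1: "cos \<theta> * (x \<bullet> j) - sin \<theta> * (x \<bullet> k) = 0" "sin \<theta> * (x \<bullet> j) + cos \<theta> * (x \<bullet> k) = 0"
      using plane_rotation_inner(1,2)[OF jk, of \<theta> x] x by simp_all
    have cs: "cos \<theta> ^ 2 + sin \<theta> ^ 2 = 1" by simp
    have "x \<bullet> j = 0" using 1 cs by algebra
    moreover have "x \<bullet> k = 0" using 1 cs by algebra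
    ultimately show "x \<bullet> i = 0 \<bullet> i"
      using plane_rotation_inner(3)[OF jk i, of \<theta> x] x by auto
  qed
  then show ?thesis using linear_injective_0[OF linear_plane_rotation] by blast
qed

text \<open>A quarter turn sends \<open>j\<close> to \<open>k\<close> and \<open>k\<close> to
  \<open>- j\<close>. The turned box has its side \<open>a k\<close> along \<open>- j\<close> and
  its side \<open>a j\<close> along \<open>k\<close>, so shifting it by
  \<open>a k *\<^sub>R j\<close> gives the unrotated box with these two sides swapped.\<close>

lemma pbox_quarter_rotation:
  fixes j k :: "'a::euclidean_space"
  assumes jk: "j \<in> Basis" "k \<in> Basis" "j \<noteq> k"
  shows "pbox (plane_rotation j k (pi / 2)) a =
    (\<lambda>x. x + (- a k) *\<^sub>R j) ` pbox (\<lambda>x. x) (a \<circ> Transposition.transpose j k)"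
proof -
  let ?r = "plane_rotation j k (pi / 2)"
  let ?Q = "{x. \<forall>i\<in>Basis. 0 \<le> x \<bullet> i \<and> x \<bullet> i \<le> a i}"
  define s where "s y = y + (a k - y \<bullet> j) *\<^sub>R j" for y :: 'a
  note r = plane_rotation_inner[OF jk, where \<theta>="pi / 2", simplified]
  show ?thesis
  proof (intro equalityI subsetI)
    fix y assume "y \<in> pbox ?r a"
    then obtain x where x: "x \<in> ?Q" "y = ?r x" by (auto simp: pbox_def)
    have "0 \<le> (y + a k *\<^sub>R j) \<bullet> i \<and> (y + a k *\<^sub>R j) \<bullet> i \<le> a (Transposition.transpose j k i)" if i: "i \<in> Basis" for i
    proof -
      consider "i = j" | "i = k" | "i \<noteq> j" "i \<noteq> k" by blast
      then show ?thesis
      proof cases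
        case 3
        then show ?thesis using x i jk r(3)[OF i] by (simp add: inner_add_left inner_Basis)
      qed (use x jk r in \<open>auto simp: inner_add_left inner_Basis\<close>)
    qed
    then have "y + a k *\<^sub>R j \<in> pbox (\<lambda>x. x) (a \<circ> Transposition.transpose j k)" by (simp add: pbox_def)
    then show "y \<in> (\<lambda>x. x + (- a k) *\<^sub>R j) ` pbox (\<lambda>x. x) (a \<circ> Transposition.transpose j k)"
      by (intro image_eqI[of _ _ "y + a k *\<^sub>R j"]) auto
  next
    fix y assume "y \<in> (\<lambda>x. x + (- a k) *\<^sub>R j) ` pbox (\<lambda>x. x) (a \<circ> Transposition.transpose j k)"
    then obtain z where z: "y = z - a k *\<^sub>R j"
      "\<And>i. i \<in> Basis \<Longrightarrow> 0 \<le> z \<bullet> i \<and> z \<bullet> i \<le> a (Transposition.transpose j k i)"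
      by (auto simp: pbox_def)
    \<comment> \<open>The preimage of \<open>y\<close> under the quarter turn, found by solving for
      its \<open>j\<close> and \<open>k\<close> coordinates.\<close>
    define x where "x = z + (z \<bullet> k - z \<bullet> j) *\<^sub>R j + (a k - z \<bullet> j - z \<bullet> k) *\<^sub>R k"
    have xj: "x \<bullet> j = z \<bullet> k" "x \<bullet> k = a k - z \<bullet> j"
      using jk by (simp_all add: x_def inner_add_left inner_Basis)
    have xi: "x \<bullet> i = z \<bullet> i" if "i \<in> Basis" "i \<noteq> j" "i \<noteq> k" for i
      using jk that by (simp add: x_def inner_add_left inner_Basis)
    have "0 \<le> x \<bullet> i \<and> x \<bullet> i \<le> a i" if i: "i \<in> Basis" for i
    proof -
      consider "i = j" | "i = k" | "i \<noteq> j" "i \<noteq> k" by blast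
      then show ?thesis
      proof cases
        case 3
        then show ?thesis using xi[OF i] z(2)[OF i] by simp
      qed (use xj z(2)[OF jk(1)] z(2)[OF jk(2)] in auto)
    qed
    moreover have "?r x = y"
    proof (rule euclidean_eqI)
      fix i :: 'a assume i: "i \<in> Basis"
      consider "i = j" | "i = k" | "i \<noteq> j" "i \<noteq> k" by blast
      then show "?r x \<bullet> i = y \<bullet> i"
      proof cases
        case 3
        then show ?thesis using xi[OF i] r(3)[OF i] i jk by (simp add: z(1) inner_diff_left inner_Basis)
      qed (use xj jk r in \<open>auto simp: z(1) inner_diff_left inner_Basis\<close>)
    qed
    ultimately show "y \<in> pbox ?r a" by (auto simp: pbox_def)
  qed
qed

text \<open>The difference lies in the plane of \<open>j\<close> and \<open>k\<close>. The bound is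
  uniform over bounded sets of \<open>x\<close>, as needed for the Hausdorff distance of rotated
  boxes.\<close>

lemma norm_plane_rotation_diff_le:
  assumes "j \<in> Basis" "k \<in> Basis"
  shows "norm (plane_rotation j k \<theta> x - plane_rotation j k \<theta>' x)
    \<le> 2 * (\<bar>cos \<theta> - cos \<theta>'\<bar> + \<bar>sin \<theta> - sin \<theta>'\<bar>) * norm x"
proof -
  define c s where "c = cos \<theta> - cos \<theta>'" and "s = sin \<theta> - sin \<theta>'"
  define p q where "p = c * (x \<bullet> j) - s * (x \<bullet> k)" and "q = s * (x \<bullet> j) + c * (x \<bullet> k)"
  have eq: "plane_rotation j k \<theta> x - plane_rotation j k \<theta>' x = p *\<^sub>R j + q *\<^sub>R k"
    by (simp add: plane_rotation_def c_def s_def p_def q_def algebra_simps)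
  have b: "\<bar>x \<bullet> j\<bar> \<le> norm x" "\<bar>x \<bullet> k\<bar> \<le> norm x" using assms by (auto simp: Basis_le_norm)
  have "\<bar>p\<bar> \<le> \<bar>c\<bar> * norm x + \<bar>s\<bar> * norm x"
    unfolding p_def
    using b by (intro order_trans[OF abs_triangle_ineq4] add_mono) (auto simp: abs_mult intro!: mult_left_mono)
  moreover have "\<bar>q\<bar> \<le> \<bar>s\<bar> * norm x + \<bar>c\<bar> * norm x"
    unfolding q_def
    using b by (intro order_trans[OF abs_triangle_ineq] add_mono) (auto simp: abs_mult intro!: mult_left_mono)
  moreover have "norm (p *\<^sub>R j + q *\<^sub>R k) \<le> \<bar>p\<bar> + \<bar>q\<bar>"
    using norm_triangle_ineq[of "p *\<^sub>R j" "q *\<^sub>R k"] assms by simp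
  ultimately show ?thesis
    unfolding eq c_def[symmetric] s_def[symmetric] by (simp add: algebra_simps)
qed

section \<open>Active sets of edges\<close>

context volume_constrained_valuation
begin

text \<open>The coefficient at \<open>{}\<close> is the value at zero sides, where the box is the
  point \<open>{0}\<close>.\<close>

lemma coef_body_empty:
  assumes "linear g"
  shows "coef_body g {} = differences (\<Phi> {0})"
proof -
  have "pbox g (indicator {}) = {0}"
    using assms by (simp add: pbox_cbox linear_0 indicator_def)
  then have "coef (box_width g u) {} = width (\<Phi> {0}) u" for u
    by (simp add: coef_def box_width_def)
  moreover have "{0 :: 'a} \<in> convex_bodies" by (simp add: convex_bodies_def)
  ultimately show ?thesis
    using differences_iff_width[OF \<Phi>_convex_bodies] by (auto simp: coef_body_def)
qed

text \<open>That is, the coefficient body of \<open>I\<close> is not contained in the direction space of \<open>\<Phi> {0}\<close>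
  (see \<open>active_iff\<close>); in this form the condition is visibly open in \<open>g\<close>.\<close>

definition active :: "('a \<Rightarrow> 'a) \<Rightarrow> 'a set \<Rightarrow> bool" where
  "active g I \<longleftrightarrow> I \<subseteq> Basis \<and>
    (\<exists>u. (\<forall>v\<in>differences (\<Phi> {0}). u \<bullet> v = 0) \<and> 0 < coef (box_width g u) I)"

text \<open>A vector with positive product with \<open>u\<close> is not in a space orthogonal to
  \<open>u\<close>. Conversely, the component \<open>u\<close> of \<open>v\<close> orthogonal to the
  direction space satisfies \<open>v \<bullet> u = u \<bullet> u > 0\<close>.\<close>

lemma active_iff:
  assumes g: "linear g" "inj g"
  shows "active g I \<longleftrightarrow> I \<subseteq> Basis \<and> \<not> coef_body g I \<subseteq> span (differences (\<Phi> {0}))"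
proof (intro iffI conjI)
  assume act: "active g I"
  then show I: "I \<subseteq> Basis" by (simp add: active_def)
  obtain u where u: "\<And>v. v \<in> differences (\<Phi> {0}) \<Longrightarrow> u \<bullet> v = 0" "0 < coef (box_width g u) I"
    using act by (auto simp: active_def)
  have "orthogonal u v" if "v \<in> span (differences (\<Phi> {0}))" for v
    using that by (rule orthogonal_to_span) (use u(1) in \<open>simp add: orthogonal_def\<close>)
  moreover obtain v where "v \<in> coef_body g I" "v \<bullet> u = coef (box_width g u) I"
    using coef_body_attained[OF g I] by blast
  ultimately show "\<not> coef_body g I \<subseteq> span (differences (\<Phi> {0}))"
    using u(2) by (metis inner_commute less_irrefl orthogonal_def subsetD)
next
  assume I: "I \<subseteq> Basis \<and> \<not> coef_body g I \<subseteq> span (differences (\<Phi> {0}))"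
  then obtain v where v: "v \<in> coef_body g I" "v \<notin> span (differences (\<Phi> {0}))" by blast
  obtain y u where yu: "y \<in> span (differences (\<Phi> {0}))" "v = y + u"
    "\<And>w. w \<in> span (differences (\<Phi> {0})) \<Longrightarrow> orthogonal u w"
    using orthogonal_subspace_decomp_exists by metis
  have "u \<noteq> 0" using v(2) yu by auto
  have "0 < u \<bullet> u" using \<open>u \<noteq> 0\<close> by simp
  also have "\<dots> = v \<bullet> u" using yu(3)[OF yu(1)] by (simp add: yu(2) inner_add_left orthogonal_def inner_commute[of y])
  also have "\<dots> \<le> coef (box_width g u) I" using v(1) by (simp add: coef_body_def)
  finally have "0 < coef (box_width g u) I" .
  moreover have "\<forall>w\<in>differences (\<Phi> {0}). u \<bullet> w = 0"
    using yu(3) span_superset[of "differences (\<Phi> {0})"] unfolding orthogonal_def by blast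
  ultimately show "active g I" using I unfolding active_def by blast
qed

lemma labelled_basis:
  assumes g: "linear g" "inj g" and S: "independent S" "S \<subseteq> (\<Union>I\<in>Pow Basis. coef_body g I)"
  obtains B where "S \<subseteq> B" "independent B" "card B = DIM('a)" "B \<subseteq> (\<Union>I\<in>Pow Basis. coef_body g I)"
proof -
  let ?U = "\<Union>I\<in>Pow Basis. coef_body g I"
  obtain B where B: "S \<subseteq> B" "B \<subseteq> ?U" "independent B" "?U \<subseteq> span B"
    using maximal_independent_subset_extend[OF S(2,1)] by blast
  have "span ?U \<subseteq> span B" using B(4) by (simp add: span_minimal)
  then have "span B = UNIV" using span_coef_bodies[OF g] by auto
  then have "card B = DIM('a)"
    using B(3) by (metis dim_eq_card_independent dim_eq_full)
  then show ?thesis using that B by blast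
qed

text \<open>Steinitz exchange: if active vectors of \<open>I\<close> and \<open>J\<close> are dependent modulo the direction space of
  \<open>\<Phi> {0}\<close>, one replaces the other in a basis, so the label counts force \<open>I = J\<close>.\<close>

lemma active_disjoint:
  assumes g: "linear g" "inj g" and I: "active g I" and J: "active g J" and "I \<noteq> J"
  shows "I \<inter> J = {}"
proof (rule ccontr)
  assume "I \<inter> J \<noteq> {}"
  then obtain i where i: "i \<in> I" "i \<in> J" by blast
  let ?E = "differences (\<Phi> {0})" and ?U = "\<Union>I\<in>Pow Basis. coef_body g I"
  have E: "coef_body g {} = ?E" using coef_body_empty[OF g(1)] .
  have IJ: "I \<subseteq> Basis" "J \<subseteq> Basis" using I J by (auto simp: active_def)
  obtain v where v: "v \<in> coef_body g I" "v \<notin> span ?E" using I active_iff[OF g] by blast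
  obtain w where w: "w \<in> coef_body g J" "w \<notin> span ?E" using J active_iff[OF g] by blast
  obtain B0 where B0: "B0 \<subseteq> ?E" "independent B0" "?E \<subseteq> span B0"
    using maximal_independent_subset by blast
  have spanB0: "span B0 = span ?E"
    using B0 by (metis span_eq span_mono span_superset subset_trans)
  have U: "v \<in> ?U" "w \<in> ?U" "B0 \<subseteq> ?U" using v w IJ B0(1) E by auto
  have ind: "independent (insert v B0)" using B0(2) v(2) spanB0 by (simp add: independent_insertI)
  \<comment> \<open>A vector may lie in several coefficient bodies, so some label is chosen; at
    \<open>v\<close> and \<open>w\<close> it is overridden below by \<open>I\<close> and
    \<open>J\<close>.\<close>
  define label where "label x = (SOME L. L \<subseteq> Basis \<and> x \<in> coef_body g L)" for x
  have label: "label x \<subseteq> Basis \<and> x \<in> coef_body g (label x)" if "x \<in> ?U" for x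
  proof -
    have "\<exists>L. L \<subseteq> Basis \<and> x \<in> coef_body g L" using that by blast
    then show ?thesis unfolding label_def by (rule someI_ex)
  qed
  show False
  proof (cases "w \<in> span (insert v B0)")
    \<comment> \<open>Here \<open>v\<close> and \<open>w\<close> fit into one basis with labels
      \<open>I\<close> and \<open>J\<close>, so \<open>i\<close> is counted twice.\<close>
    case False
    then have ind_w: "independent (insert w (insert v B0))" using ind by (simp add: independent_insertI)
    have "insert w (insert v B0) \<subseteq> ?U" using U by simp
    then obtain B where B: "insert w (insert v B0) \<subseteq> B" "independent B" "card B = DIM('a)" "B \<subseteq> ?U"
      by (rule labelled_basis[OF g ind_w])
    define \<iota> where "\<iota> = label(v := I, w := J)"
    have "v \<noteq> w" using False by (metis insertI1 span_base)
    then have "\<iota> x \<subseteq> Basis \<and> x \<in> coef_body g (\<iota> x)" if "x \<in> B" for x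
      using that B(4) label IJ v(1) w(1) by (auto simp: \<iota>_def)
    then have "card {x \<in> B. i \<in> \<iota> x} = 1"
      using i IJ by (intro coef_body_basis_label[OF g B(2,3)]) auto
    moreover have "{v, w} \<subseteq> {x \<in> B. i \<in> \<iota> x}" using B(1) i by (auto simp: \<iota>_def)
    ultimately show False using \<open>v \<noteq> w\<close> by (metis card_1_singletonE insert_subset singletonD)
  next
    case True
    have "insert v B0 \<subseteq> ?U" using U by simp
    then obtain B where B: "insert v B0 \<subseteq> B" "independent B" "card B = DIM('a)" "B \<subseteq> ?U"
      by (rule labelled_basis[OF g ind])
    have finB: "finite B" using B(2) by (rule finiteI_independent)
    define R where "R = B - {v}"
    have "v \<notin> B0" using v(2) spanB0 span_base[of v B0] by blast
    then have R: "B = insert v R" "v \<notin> R" "finite R" "B0 \<subseteq> R"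
      using B(1) finB by (auto simp: R_def)
    have indR: "independent R" "v \<notin> span R"
      using B(2) independent_insert[of v R] R(1,2) by auto
    \<comment> \<open>Modulo \<open>span B0\<close>, \<open>w\<close> is a nonzero multiple of
      \<open>v\<close>, so \<open>w\<close> in \<open>span R\<close> would put \<open>v\<close>
      there too. Hence \<open>w\<close> can replace \<open>v\<close> in the basis.\<close>
    have wR: "w \<notin> span R"
    proof
      assume "w \<in> span R"
      obtain c where c: "w - c *\<^sub>R v \<in> span B0" using True by (auto simp: span_insert)
      then have "c \<noteq> 0" using w(2) unfolding spanB0 by auto
      have "w - (w - c *\<^sub>R v) \<in> span R"
        using \<open>w \<in> span R\<close> subsetD[OF span_mono[OF R(4)] c] by (rule span_diff)
      then have "(1 / c) *\<^sub>R (w - (w - c *\<^sub>R v)) \<in> span R" by (rule span_scale)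
      then show False using indR(2) \<open>c \<noteq> 0\<close> by simp
    qed
    have card1: "card {x \<in> insert z R. k \<in> (label(z := L)) x} = 1"
      if "k \<in> Basis" "z \<notin> span R" "L \<subseteq> Basis" "z \<in> coef_body g L" for z L k
    proof (rule coef_body_basis_label[OF g _ _ _ \<open>k \<in> Basis\<close>])
      have "z \<notin> R" using \<open>z \<notin> span R\<close> span_base by blast
      then show "card (insert z R) = DIM('a)" using R B(3) by simp
      show "independent (insert z R)" using indR(1) \<open>z \<notin> span R\<close> by (simp add: independent_insertI)
      fix x assume "x \<in> insert z R"
      then have "x = z \<or> x \<noteq> z \<and> x \<in> ?U" using B(4) R(1) by blast
      then show "(label(z := L)) x \<subseteq> Basis \<and> x \<in> coef_body g ((label(z := L)) x)"
        using label[of x] that(3,4) by (elim disjE) simp_all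
    qed
    have card_v: "card {x \<in> insert v R. k \<in> (label(v := I)) x} = 1" if "k \<in> Basis" for k
      using card1 that indR(2) IJ(1) v(1) by blast
    have card_w: "card {x \<in> insert w R. k \<in> (label(w := J)) x} = 1" if "k \<in> Basis" for k
      using card1 that wR IJ(2) w(1) by blast
    have w_notin: "w \<notin> R" using wR span_base by blast
    have count: "card {x \<in> insert z R. k \<in> (label(z := L)) x} =
        (if k \<in> L then 1 else 0) + card {x \<in> R. k \<in> label x}" if "z \<notin> R" for z L k
    proof -
      have "{x \<in> insert z R. k \<in> (label(z := L)) x} =
          (if k \<in> L then insert z {x \<in> R. k \<in> label x} else {x \<in> R. k \<in> label x})"
        using that by auto
      then show ?thesis using that R(3) by simp
    qed
    \<comment> \<open>The two bases share \<open>R\<close> with the same labels, so equal counts at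
      \<open>k\<close> force \<open>I\<close> and \<open>J\<close> to agree at
      \<open>k\<close>.\<close>
    have "k \<in> I \<longleftrightarrow> k \<in> J" if "k \<in> Basis" for k
      using card_v[OF that, unfolded count[OF R(2)]] card_w[OF that, unfolded count[OF w_notin]]
      by (auto split: if_splits)
    then show False using IJ \<open>I \<noteq> J\<close> by auto
  qed
qed

text \<open>A basis of the direction space gets the label \<open>{}\<close> and is extended; by
  independence the added vectors lie outside that space, so their labels are active. The counts say
  that these labels partition the edges.\<close>

lemma labelled_basis_over_direction_space:
  assumes g: "linear g" "inj g"
  obtains B0 B :: "'a set" and \<iota> where "B0 \<subseteq> B" "finite B" "card B = DIM('a)" "card B0 = dim (differences (\<Phi> {0}))"
    "\<forall>x\<in>B0. \<iota> x = {}" "\<forall>x\<in>B - B0. active g (\<iota> x)"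
    "\<forall>i\<in>Basis. card {x \<in> B. i \<in> \<iota> x} = 1"
proof -
  let ?E = "differences (\<Phi> {0})" and ?U = "\<Union>I\<in>Pow Basis. coef_body g I"
  have E: "coef_body g {} = ?E" using coef_body_empty[OF g(1)] .
  obtain B0 where B0: "B0 \<subseteq> ?E" "independent B0" "?E \<subseteq> span B0" "card B0 = dim ?E"
    using basis_exists by blast
  have "B0 \<subseteq> ?U" using B0(1) E by auto
  then obtain B where B: "B0 \<subseteq> B" "independent B" "card B = DIM('a)" "B \<subseteq> ?U"
    by (rule labelled_basis[OF g B0(2)])
  have finB: "finite B" using B(2) by (rule finiteI_independent)
  define \<iota> where "\<iota> x = (if x \<in> B0 then {} else SOME L. L \<subseteq> Basis \<and> x \<in> coef_body g L)" for x
  have \<iota>: "\<iota> x \<subseteq> Basis \<and> x \<in> coef_body g (\<iota> x)" if "x \<in> B" for x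
  proof (cases "x \<in> B0")
    case False
    have "\<exists>L. L \<subseteq> Basis \<and> x \<in> coef_body g L" using that B(4) by blast
    from someI_ex[OF this] show ?thesis using False by (simp add: \<iota>_def)
  qed (use B0(1) E in \<open>auto simp: \<iota>_def\<close>)
  have "active g (\<iota> x)" if "x \<in> B - B0" for x
  proof -
    have "x \<notin> span (B - {x})" using B(2) that by (auto simp: dependent_def)
    then have "x \<notin> span B0" using span_mono[of B0 "B - {x}"] B(1) that by blast
    moreover have "span ?E \<subseteq> span B0" using B0(3) by (simp add: span_minimal)
    ultimately show ?thesis using \<iota> that active_iff[OF g] by blast
  qed
  moreover have "card {x \<in> B. i \<in> \<iota> x} = 1" if "i \<in> Basis" for i
    using that \<iota> by (intro coef_body_basis_label[OF g B(2,3)])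
  ultimately show ?thesis
    using that[of B0 B \<iota>] B finB B0(4) by (simp add: \<iota>_def)
qed

section \<open>The edge partition formed by the active sets\<close>

lemma active_nonempty:
  assumes "linear g" "inj g" "active g I"
  shows "I \<noteq> {}"
proof
  assume "I = {}"
  then show False
    using assms(3) span_superset[of "differences (\<Phi> {0})"]
    by (simp add: active_iff[OF assms(1,2)] coef_body_empty[OF assms(1)])
qed

lemma active_cover:
  assumes g: "linear g" "inj g" and i: "i \<in> Basis"
  obtains I where "active g I" "i \<in> I"
proof -
  obtain B0 B :: "'a set" and \<iota> where *: "B0 \<subseteq> B" "finite B" "card B = DIM('a)" "card B0 = dim (differences (\<Phi> {0}))"
    "\<forall>x\<in>B0. \<iota> x = {}" "\<forall>x\<in>B - B0. active g (\<iota> x)"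
    "\<forall>i\<in>Basis. card {x \<in> B. i \<in> \<iota> x} = 1"
    by (rule labelled_basis_over_direction_space[OF g])
  from bspec[OF *(7) i] obtain x where "{x \<in> B. i \<in> \<iota> x} = {x}" by (rule card_1_singletonE)
  then have x: "x \<in> B" "i \<in> \<iota> x" by auto
  then have "x \<in> B - B0" using *(5) by auto
  then show ?thesis using that *(6) x(2) by blast
qed

text \<open>In full dimension every label would be \<open>{}\<close>, and no edge would be
  counted.\<close>

lemma dim_differences_less: "dim (differences (\<Phi> {0})) < DIM('a)"
proof (rule ccontr)
  assume n: "\<not> ?thesis"
  have g: "linear (\<lambda>x::'a. x)" "inj (\<lambda>x::'a. x)" by (auto simp: linear_ident)
  obtain B0 B :: "'a set" and \<iota> where *: "B0 \<subseteq> B" "finite B" "card B = DIM('a)" "card B0 = dim (differences (\<Phi> {0}))"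
    "\<forall>x\<in>B0. \<iota> x = {}" "\<forall>x\<in>B - B0. active (\<lambda>x. x) (\<iota> x)"
    "\<forall>i\<in>Basis. card {x \<in> B. i \<in> \<iota> x} = 1"
    by (rule labelled_basis_over_direction_space[OF g])
  have "B0 = B" using n *(1,2,3,4) by (intro card_seteq) auto
  moreover obtain i :: 'a where "i \<in> Basis" using nonempty_Basis by blast
  ultimately have "{x \<in> B. i \<in> \<iota> x} = {}" "card {x \<in> B. i \<in> \<iota> x} = 1"
    using *(5,7) by auto
  then show False by (metis card.empty zero_neq_one)
qed

text \<open>With \<open>d\<close> the dimension of the direction space, \<open>DIM('a) - d\<close>
  labels partition the edges. As \<open>0 < d\<close>, some label has two elements; as
  \<open>d + 2 \<le> DIM('a)\<close>, there is another label, which supplies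
  \<open>k\<close>.\<close>

lemma active_nontrivial:
  assumes g: "linear g" "inj g"
    and "0 < dim (differences (\<Phi> {0}))" "dim (differences (\<Phi> {0})) + 2 \<le> DIM('a)"
  obtains I i j k where "active g I" "i \<in> I" "j \<in> I" "i \<noteq> j" "k \<in> Basis" "k \<notin> I"
proof -
  obtain B0 B :: "'a set" and \<iota> where *: "B0 \<subseteq> B" "finite B" "card B = DIM('a)" "card B0 = dim (differences (\<Phi> {0}))"
    "\<forall>x\<in>B0. \<iota> x = {}" "\<forall>x\<in>B - B0. active g (\<iota> x)"
    "\<forall>i\<in>Basis. card {x \<in> B. i \<in> \<iota> x} = 1"
    by (rule labelled_basis_over_direction_space[OF g])
  have card: "card (B - B0) = DIM('a) - dim (differences (\<Phi> {0}))"
    using * by (simp add: card_Diff_subset finite_subset)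
  have sub: "\<iota> x \<subseteq> Basis" if "x \<in> B" for x
    using *(5,6) that by (cases "x \<in> B0") (auto simp: active_def)
  \<comment> \<open>Double counting of the pairs of a basis vector and an edge in its label.\<close>
  have "(\<Sum>x\<in>B. card {i \<in> Basis. i \<in> \<iota> x}) = (\<Sum>i\<in>(Basis :: 'a set). 1)"
    using *(2,7) by (intro sum_multicount_gen) auto
  then have "(\<Sum>x\<in>B. card (\<iota> x)) = DIM('a)"
    using sub by (simp add: Collect_conj_eq Int_absorb1 cong: sum.cong)
  moreover have "(\<Sum>x\<in>B. card (\<iota> x)) = (\<Sum>x\<in>B - B0. card (\<iota> x))"
    using * by (intro sum.mono_neutral_right) auto
  ultimately have sum: "(\<Sum>x\<in>B - B0. card (\<iota> x)) = DIM('a)" by simp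
  have "\<exists>x\<in>B - B0. 2 \<le> card (\<iota> x)"
  proof (rule ccontr)
    assume "\<not> ?thesis"
    then have "(\<Sum>x\<in>B - B0. card (\<iota> x)) \<le> (\<Sum>x\<in>B - B0. 1)" by (intro sum_mono) force
    then have "DIM('a) \<le> card (B - B0)" unfolding sum by simp
    then show False using card assms(3) DIM_positive[where 'a='a] by linarith
  qed
  then obtain x where x: "x \<in> B - B0" "2 \<le> card (\<iota> x)" by blast
  then have "\<not> card (\<iota> x) \<le> Suc 0" "finite (\<iota> x)"
    by (auto intro: card_ge_0_finite)
  then obtain i j where ij: "i \<in> \<iota> x" "j \<in> \<iota> x" "i \<noteq> j"
    using card_le_Suc0_iff_eq by blast
  have "B - B0 \<noteq> {x}" using card assms(4) by auto
  then obtain y where y: "y \<in> B - B0" "y \<noteq> x" using x(1) by blast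
  obtain k where k: "k \<in> \<iota> y" using active_nonempty[OF g bspec[OF *(6) y(1)]] by blast
  then have kB: "k \<in> Basis" using sub y(1) by blast
  have "k \<notin> \<iota> x"
  proof
    assume "k \<in> \<iota> x"
    then have "{x, y} \<subseteq> {x \<in> B. k \<in> \<iota> x}" using k x y by blast
    then show False using bspec[OF *(7) kB] y(2) by (metis card_1_singletonE insert_subset singletonD)
  qed
  then show ?thesis using that[OF bspec[OF *(6) x(1)] ij kB] by blast
qed

section \<open>Dependence on the rotation angle\<close>

lemma isCont_box_width_rotation:
  assumes jk: "j \<in> Basis" "k \<in> Basis" and a: "\<And>i. i \<in> Basis \<Longrightarrow> 0 \<le> a i"
  shows "isCont (\<lambda>\<theta>. box_width (plane_rotation j k \<theta>) u a) \<theta>\<^sub>0"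
  unfolding isCont_def
proof (rule tendstoI)
  fix e :: real assume e: "0 < e"
  let ?Q = "{x. \<forall>i\<in>Basis. 0 \<le> x \<bullet> i \<and> x \<bullet> i \<le> a i}"
  let ?K = "\<lambda>\<theta>. pbox (plane_rotation j k \<theta>) a"
  have K: "?K \<theta> \<in> convex_bodies" for \<theta>
    using linear_plane_rotation a by (rule pbox_convex_bodies)
  have "bounded ?Q"
    using bounded_cbox[of 0 "\<Sum>i\<in>Basis. a i *\<^sub>R i"] by (simp add: cbox_def)
  then obtain M where M: "\<forall>x\<in>?Q. norm x \<le> M" unfolding bounded_iff by (rule exE)
  \<comment> \<open>The added \<open>1\<close> keeps the denominator of \<open>e'\<close> positive
    when \<open>u = 0\<close>. The \<open>4\<close> in \<open>e'\<close> leaves \<open>e / 2\<close>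
    after the factor \<open>2\<close> of \<open>width_hausdorff_le\<close>.\<close>
  define N where "N = norm u + 1"
  define e' where "e' = e / (4 * N)"
  have N: "0 < N" by (simp add: N_def add_nonneg_pos)
  have e': "0 < e'" using e N by (simp add: e'_def)
  obtain d where d: "0 < d" "\<And>L. L \<in> convex_bodies \<Longrightarrow> hausdorff_dist L (?K \<theta>\<^sub>0) < d \<Longrightarrow>
      hausdorff_dist (\<Phi> L) (\<Phi> (?K \<theta>\<^sub>0)) < e'"
    using continuous K e' unfolding hausdorff_continuous_def by metis
  \<comment> \<open>Bounds the displacement of all points of \<open>?Q\<close> at once, and so the
    Hausdorff distance of the two rotated boxes.\<close>
  define m where "m \<theta> = 2 * (\<bar>cos \<theta> - cos \<theta>\<^sub>0\<bar> + \<bar>sin \<theta> - sin \<theta>\<^sub>0\<bar>) * M" for \<theta>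
  have "(m \<longlongrightarrow> 2 * (\<bar>cos \<theta>\<^sub>0 - cos \<theta>\<^sub>0\<bar> + \<bar>sin \<theta>\<^sub>0 - sin \<theta>\<^sub>0\<bar>) * M) (at \<theta>\<^sub>0)"
    unfolding m_def by (intro tendsto_intros)
  then have "\<forall>\<^sub>F \<theta> in at \<theta>\<^sub>0. m \<theta> < d" using d(1) by (intro order_tendstoD(2)) auto
  then show "\<forall>\<^sub>F \<theta> in at \<theta>\<^sub>0. dist (box_width (plane_rotation j k \<theta>) u a)
      (box_width (plane_rotation j k \<theta>\<^sub>0) u a) < e"
  proof eventually_elim
    case (elim \<theta>)
    have m: "dist (plane_rotation j k \<theta> x) (plane_rotation j k \<theta>\<^sub>0 x) \<le> m \<theta>" if "x \<in> ?Q" for x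
      unfolding dist_norm m_def using bspec[OF M that]
      by (intro order_trans[OF norm_plane_rotation_diff_le[OF jk]] mult_left_mono) auto
    have "hausdorff_dist (?K \<theta>) (?K \<theta>\<^sub>0) \<le> m \<theta>"
    proof (rule hausdorff_dist_le[OF K K])
      fix y assume "y \<in> ?K \<theta>"
      then obtain x where "x \<in> ?Q" "y = plane_rotation j k \<theta> x" unfolding pbox_def by blast
      then show "\<exists>z\<in>?K \<theta>\<^sub>0. dist y z \<le> m \<theta>" using m unfolding pbox_def by blast
    next
      fix y assume "y \<in> ?K \<theta>\<^sub>0"
      then obtain x where "x \<in> ?Q" "y = plane_rotation j k \<theta>\<^sub>0 x" unfolding pbox_def by blast
      then show "\<exists>z\<in>?K \<theta>. dist z y \<le> m \<theta>" using m unfolding pbox_def by blast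
    qed
    then have "hausdorff_dist (\<Phi> (?K \<theta>)) (\<Phi> (?K \<theta>\<^sub>0)) < e'" using elim d(2)[OF K] by simp
    then have "\<bar>width (\<Phi> (?K \<theta>)) u - width (\<Phi> (?K \<theta>\<^sub>0)) u\<bar> \<le> 2 * e' * norm u"
      using width_hausdorff_le[OF \<Phi>_convex_bodies[OF K] \<Phi>_convex_bodies[OF K]] by blast
    also have "\<dots> \<le> 2 * e' * N" using e' by (intro mult_left_mono) (auto simp: N_def)
    also have "\<dots> = e / 2" using N by (simp add: e'_def)
    also have "\<dots> < e" using e by simp
    finally show ?case by (simp add: box_width_def dist_real_def)
  qed
qed

text \<open>For fixed \<open>u\<close> the coefficient is a finite sum of functions continuous in
  the angle, so its positivity is an open condition; the union over admissible \<open>u\<close>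
  stays open.\<close>

lemma open_active_rotation:
  assumes jk: "j \<in> Basis" "k \<in> Basis"
  shows "open {\<theta>. active (plane_rotation j k \<theta>) I}"
proof (cases "I \<subseteq> Basis")
  case True
  have "continuous_on UNIV (\<lambda>\<theta>. coef (box_width (plane_rotation j k \<theta>) u) I)" for u
    unfolding coef_def using jk
    by (intro continuous_intros continuous_at_imp_continuous_on ballI isCont_box_width_rotation) auto
  then have "open {\<theta>. 0 < coef (box_width (plane_rotation j k \<theta>) u) I}" for u
    by (intro open_Collect_less continuous_intros)
  then have "open (\<Union>u\<in>{u. \<forall>v\<in>differences (\<Phi> {0}). u \<bullet> v = 0}.
      {\<theta>. 0 < coef (box_width (plane_rotation j k \<theta>) u) I})" by blast
  moreover have "(\<Union>u\<in>{u. \<forall>v\<in>differences (\<Phi> {0}). u \<bullet> v = 0}.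
      {\<theta>. 0 < coef (box_width (plane_rotation j k \<theta>) u) I}) = {\<theta>. active (plane_rotation j k \<theta>) I}"
    using True by (auto simp: active_def)
  ultimately show ?thesis by simp
qed (simp add: active_def)

text \<open>The angles at which \<open>I\<close> is active form an open set, and so does the complement: it consists of
  the angles at which a competitor \<open>J \<noteq> I\<close> that meets \<open>I\<close> is active.\<close>

lemma active_rotation:
  assumes jk: "j \<in> Basis" "k \<in> Basis" "j \<noteq> k" and act: "active (\<lambda>x. x) I"
  shows "active (plane_rotation j k \<theta>) I"
proof -
  let ?S = "\<lambda>J. {\<theta>. active (plane_rotation j k \<theta>) J}"
  note rot = linear_plane_rotation[of j k] inj_plane_rotation[OF jk]
  obtain i where i: "i \<in> I"
    using act active_nonempty[of "\<lambda>x. x" I] linear_ident by (auto simp: linear_iff)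
  have iB: "i \<in> Basis" using i act by (auto simp: active_def)
  have "- ?S I = (\<Union>J\<in>{J. i \<in> J \<and> J \<noteq> I}. ?S J)"
  proof (intro equalityI subsetI)
    fix t assume "t \<in> - ?S I"
    moreover obtain J where "active (plane_rotation j k t) J" "i \<in> J"
      using active_cover[OF rot iB] by blast
    ultimately show "t \<in> (\<Union>J\<in>{J. i \<in> J \<and> J \<noteq> I}. ?S J)" by auto
  qed (use active_disjoint[OF rot] i in blast)
  then have "closed (?S I)"
    using open_active_rotation[OF jk(1,2)] by (simp add: closed_def open_UN)
  moreover have "0 \<in> ?S I" using act by simp
  \<comment> \<open>Connectedness of the real line: \<open>?S I\<close> is open, closed and contains
    \<open>0\<close>.\<close>
  ultimately have "?S I = UNIV"
    using open_active_rotation[OF jk(1,2), of I] clopen[of "?S I"] by (metis empty_iff)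
  then show ?thesis by (metis UNIV_I mem_Collect_eq)
qed

text \<open>\<open>I\<close> stays active up to the angle \<open>pi / 2\<close>, where each box is a
  translate of the unrotated one with two sides swapped. By translation invariance its coefficient
  at \<open>I\<close> is that of the original frame at the transposed set.\<close>

lemma active_transpose:
  assumes jk: "j \<in> Basis" "k \<in> Basis" "j \<noteq> k" and act: "active (\<lambda>x. x) I"
  shows "active (\<lambda>x. x) (Transposition.transpose j k ` I)"
proof -
  have "box_width (plane_rotation j k (pi / 2)) u (indicator J) =
      box_width (\<lambda>x. x) u (indicator (Transposition.transpose j k ` J))" for u J
  proof -
    have "indicator J \<circ> Transposition.transpose j k = (indicator (Transposition.transpose j k ` J) :: 'a \<Rightarrow> real)"
      by (auto simp: fun_eq_iff indicator_def image_iff)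
    moreover have "pbox (\<lambda>x. x) (indicator (Transposition.transpose j k ` J)) \<in> convex_bodies"
      by (intro pbox_convex_bodies linear_ident) auto
    then have "\<Phi> ((\<lambda>x. x + c *\<^sub>R j) ` pbox (\<lambda>x. x) (indicator (Transposition.transpose j k ` J))) =
        \<Phi> (pbox (\<lambda>x. x) (indicator (Transposition.transpose j k ` J)))" for c
      using translation unfolding translation_invariant_def by blast
    ultimately show ?thesis
      by (simp only: box_width_def pbox_quarter_rotation[OF jk])
  qed
  then have "coef (box_width (plane_rotation j k (pi / 2)) u) I =
      coef (box_width (\<lambda>x. x) u) (Transposition.transpose j k ` I)" for u
    by (intro coef_reindex) auto
  moreover have "Transposition.transpose j k ` I \<subseteq> Basis"
    using jk act by (auto simp: active_def Transposition.transpose_def)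
  ultimately show ?thesis
    using active_rotation[OF assms, of "pi / 2"] by (auto simp: active_def)
qed

text \<open>In an intermediate dimension some active \<open>I\<close> contains distinct
  \<open>i\<close> and \<open>j\<close> but misses \<open>k\<close>. Swapping \<open>j\<close> and
  \<open>k\<close> gives an active set that meets \<open>I\<close> in \<open>i\<close> and differs
  from it at \<open>k\<close>, against \<open>active_disjoint\<close>.\<close>

lemma dim_differences_point: "dim (differences (\<Phi> {0})) = 0 \<or> dim (differences (\<Phi> {0})) = DIM('a) - 1"
proof (rule ccontr)
  assume "\<not> ?thesis"
  then have d: "0 < dim (differences (\<Phi> {0}))" "dim (differences (\<Phi> {0})) + 2 \<le> DIM('a)"
    using dim_differences_less by linarith+
  have g: "linear (\<lambda>x::'a. x)" "inj (\<lambda>x::'a. x)" by (auto simp: linear_ident)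
  obtain I i j k where I: "active (\<lambda>x. x) I" "i \<in> I" "j \<in> I" "i \<noteq> j" "k \<in> Basis" "k \<notin> I"
    using active_nontrivial[OF g d] by blast
  have "j \<in> Basis" "j \<noteq> k" using I by (auto simp: active_def)
  then have "active (\<lambda>x. x) (Transposition.transpose j k ` I)" using I by (intro active_transpose) auto
  moreover have "k \<in> Transposition.transpose j k ` I" using I(3) by (metis image_eqI transpose_apply_first)
  moreover have "i \<in> Transposition.transpose j k ` I" using I by (metis image_eqI transpose_apply_other)
  ultimately show False using active_disjoint[OF g I(1), of "Transposition.transpose j k ` I"] I by blast
qed

end

theorem theorem3p1:
  fixes \<Phi> :: "'a::euclidean_space set \<Rightarrow> 'a set" and p :: 'a
  assumes "DIM('a) \<ge> 2"
    and "minkowski_valuation \<Phi>"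
    and "hausdorff_continuous \<Phi>"
    and "translation_invariant \<Phi>"
    and "volume_condition \<Phi>"
  shows "aff_dim (\<Phi> {p}) = 0 \<or> aff_dim (\<Phi> {p}) = int DIM('a) - 1"
proof -
  interpret volume_constrained_valuation \<Phi> by unfold_locales (fact assms)+
  have zero: "{0 :: 'a} \<in> convex_bodies" by (simp add: convex_bodies_def)
  then have "\<Phi> ((\<lambda>x. x + p) ` {0}) = \<Phi> {0}" using assms(4) unfolding translation_invariant_def by blast
  then have "\<Phi> {p} = \<Phi> {0}" by simp
  moreover have "aff_dim (\<Phi> {0}) = int (dim (differences (\<Phi> {0})))"
    using \<Phi>_convex_bodies[OF zero] by (intro aff_dim_eq_dim_differences convex_bodiesD(1))
  moreover have "int (DIM('a) - 1) = int DIM('a) - 1" by (simp add: of_nat_diff)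
  ultimately show ?thesis using dim_differences_point by auto
qed

end
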